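(* Let $\mathbb{G}$ be a Carnot group of nilpotency step $s$. Then the de Rham complex $(\Omega^\ast,d)$ of $\mathbb{G}$, bigraded by $\Omega^h=\bigoplus_{a+b=h}\Omega^{a,b}$ and equipped with the maps $d_i:\Omega^\ast\to\Omega^\ast$, $i=0,\dots,s$ (with $d_i=0$ for $i>s$), where $d_i$ is the component of the exterior differential $d$ that raises the weight by $i$, is a multicomplex: each $d_i$ has bidegree $(i,1-i)$, i.e. $d_i(\Omega^{a,b})\subset\Omega^{a+i,b+1-i}$, and $$\sum_{i+j=n}d_id_j=0\quad\text{for all } n\ge 0.$$
   Context: A multicomplex is a $(\mathbb{Z},\mathbb{Z})$-graded $k$-module $C$ equipped with maps $d_i:C\to C$, $i\ge 0$, of bidegree $(i,1-i)$ such that $\sum_{i+j=n}d_id_j=0$ for all $n\ge 0$. A Carnot group $\mathbb{G}$ of step $s$ is a connected, simply connected Lie group whose $n$-dimensional (real) Lie algebra has a stratification $\mathfrak{g}=V_1\oplus\cdots\oplus V_s$ with $[V_1,V_i]=V_{i+1}$, $V_s\ne 0$, $V_k=0$ for $k>s$. Fix a basis $X_1,\dots,X_n$ of $\mathfrak g$ adapted to the stratification (each $X_j$ lies in some layer $V_i$), orthonormal for an inner product making the layers mutually orthogonal, with dual basis $\theta_1,\dots,\theta_n$ of $\Lambda^1\mathfrak g^\ast$. If $X_j\in V_i$, then $\theta_j$ has weight $i$; the weight of $\theta_{j_1}\wedge\cdots\wedge\theta_{j_h}$ is the sum of the weights of its factors, and $0$-covectors have weight $0$. $\Lambda^{a,b}\mathfrak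 g^\ast$ is the span of the $(a+b)$-covectors $\theta_{j_1}\wedge\cdots\wedge\theta_{j_{a+b}}$ of weight $a$. Identifying covectors with left-invariant forms, $\Omega^h=\Lambda^h\mathfrak g^\ast\otimes C^\infty(\mathbb G)$ is the space of smooth $h$-forms on $\mathbb{G}$ and $\Omega^{a,b}=\Lambda^{a,b}\mathfrak g^\ast\otimes C^\infty(\mathbb G)$ is the space of smooth $(a+b)$-forms of weight $a$. For $\alpha\in\Omega^{p,h-p}$ one has $d\alpha=d_0\alpha+d_1\alpha+\cdots+d_s\alpha$ with $d_i\alpha$ the component of $d\alpha$ of weight $p+i$. The maps $d_i$ are understood as $\mathbb{R}$-linear maps (i.e. $k=\mathbb{R}$). *)

theory Defs
  imports
    "HOL-Analysis.Analysis"
    "HOL-Algebra.Group"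
    "HOL-Combinatorics.Permutations"
    "HOL-Library.Function_Algebras"
begin

section \<open>Direct sums and multicomplexes\<close>

definition finsupp_families :: "'i set \<Rightarrow> ('i \<Rightarrow> 'c::comm_monoid_add set) \<Rightarrow> ('i \<Rightarrow> 'c) set" where
  "finsupp_families I M =
     {v. (\<forall>i\<in>I. v i \<in> M i) \<and> (\<forall>i. i \<notin> I \<longrightarrow> v i = 0) \<and> finite {i. v i \<noteq> 0}}"

definition family_sum :: "('i \<Rightarrow> 'c::comm_monoid_add) \<Rightarrow> 'c" where
  "family_sum v = (\<Sum>i | v i \<noteq> 0. v i)"

definition is_direct_sum ::
  "('k::comm_ring_1 \<Rightarrow> 'c::ab_group_add \<Rightarrow> 'c) \<Rightarrow> 'i set \<Rightarrow> ('i \<Rightarrow> 'c set) \<Rightarrow> 'c set \<Rightarrow> bool" where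
  "is_direct_sum smul I M C \<longleftrightarrow>
     module.subspace smul C \<and> (\<forall>i\<in>I. module.subspace smul (M i)) \<and>
     bij_betw family_sum (finsupp_families I M) C"

text \<open>The component of an element of the direct sum of all \<open>M i\<close> in the summand \<open>M i\<close>.
  It is meaningful only when the sum is direct and contains the element.\<close>

definition component :: "('i \<Rightarrow> 'c::comm_monoid_add set) \<Rightarrow> 'i \<Rightarrow> 'c \<Rightarrow> 'c" where
  "component M i x = inv_into (finsupp_families UNIV M) family_sum x i"

definition multicomplex ::
  "('k::comm_ring_1 \<Rightarrow> 'c::ab_group_add \<Rightarrow> 'c) \<Rightarrow> 'c set \<Rightarrow> (int \<times> int \<Rightarrow> 'c set) \<Rightarrow>
   (nat \<Rightarrow> 'c \<Rightarrow> 'c) \<Rightarrow> bool" where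
  "multicomplex smul C M d \<longleftrightarrow>
     module smul \<and> is_direct_sum smul UNIV M C \<and>
     (\<forall>i. \<forall>x\<in>C. \<forall>y\<in>C. d i (x + y) = d i x + d i y) \<and>
     (\<forall>i c. \<forall>x\<in>C. d i (smul c x) = smul c (d i x)) \<and>
     (\<forall>i a b. d i ` M (a, b) \<subseteq> M (a + int i, b + 1 - int i)) \<and>
     (\<forall>n. \<forall>x\<in>C. (\<Sum>(i, j) | i + j = n. d i (d j x)) = 0)"


section \<open>Smooth manifolds and Lie groups\<close>

text \<open>For open \<open>S\<close> in a finite-dimensional space these are the usual classes
  \<open>C\<^sup>k\<close> and \<open>C\<^sup>\<infinity>\<close>; they are only used for open \<open>S\<close>.\<close>

fun Ck_on :: "nat \<Rightarrow> 'a::real_normed_vector set \<Rightarrow> ('a \<Rightarrow> 'b::real_normed_vector) \<Rightarrow> bool" where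
  "Ck_on 0 S f \<longleftrightarrow> continuous_on S f"
| "Ck_on (Suc k) S f \<longleftrightarrow>
     (\<forall>x\<in>S. f differentiable (at x)) \<and> (\<forall>v. Ck_on k S (\<lambda>x. frechet_derivative f (at x) v))"

definition smooth_on :: "'a::real_normed_vector set \<Rightarrow> ('a \<Rightarrow> 'b::real_normed_vector) \<Rightarrow> bool" where
  "smooth_on S f \<longleftrightarrow> (\<forall>k. Ck_on k S f)"

type_synonym ('g, 'e) chart = "'g set \<times> ('g \<Rightarrow> 'e)"

definition smooth_atlas :: "('g::topological_space, 'e::euclidean_space) chart set \<Rightarrow> bool" where
  "smooth_atlas A \<longleftrightarrow>
     (\<Union>(U, \<phi>)\<in>A. U) = UNIV \<and>
     (\<forall>(U, \<phi>)\<in>A. open U \<and> open (\<phi> ` U) \<and> (\<exists>\<psi>. homeomorphism U (\<phi> ` U) \<phi> \<psi>)) \<and>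
     (\<forall>(U, \<phi>)\<in>A. \<forall>(V, \<psi>)\<in>A. smooth_on (\<phi> ` (U \<inter> V)) (\<psi> \<circ> inv_into U \<phi>))"

definition prod_atlas ::
  "('g, 'e) chart set \<Rightarrow> ('h, 'f) chart set \<Rightarrow> ('g \<times> 'h, 'e \<times> 'f) chart set" where
  "prod_atlas A B = {(U \<times> V, map_prod \<phi> \<psi>) | U \<phi> V \<psi>. (U, \<phi>) \<in> A \<and> (V, \<psi>) \<in> B}"

definition smooth_map ::
  "('g::topological_space, 'e::euclidean_space) chart set \<Rightarrow>
   ('h::topological_space, 'f::euclidean_space) chart set \<Rightarrow> ('g \<Rightarrow> 'h) \<Rightarrow> bool" where
  "smooth_map A B f \<longleftrightarrow>
     continuous_on UNIV f \<and>
     (\<forall>(U, \<phi>)\<in>A. \<forall>(V, \<psi>)\<in>B. smooth_on (\<phi> ` (U \<inter> f -` V)) (\<psi> \<circ> f \<circ> inv_into U \<phi>))"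

definition smooth_functions ::
  "('g::topological_space, 'e::euclidean_space) chart set \<Rightarrow> ('g \<Rightarrow> real) set" where
  "smooth_functions A = {f. smooth_map A {(UNIV, id)} f}"

text \<open>The manifold is the whole type \<open>'g\<close>; Hausdorffness and second countability are
  expressed by the type classes.\<close>

definition lie_group ::
  "('g::{t2_space, second_countable_topology}) monoid \<Rightarrow> ('g, 'e::euclidean_space) chart set \<Rightarrow> bool"
where
  "lie_group G A \<longleftrightarrow>
     group G \<and> carrier G = UNIV \<and> smooth_atlas A \<and>
     smooth_map (prod_atlas A A) A (\<lambda>(x, y). x \<otimes>\<^bsub>G\<^esub> y) \<and>
     smooth_map A A (\<lambda>x. inv\<^bsub>G\<^esub> x)"


section \<open>The Lie algebra of a Lie group\<close>

instantiation "fun" :: (type, real_vector) real_vector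
begin

definition scaleR_fun :: "real \<Rightarrow> ('a \<Rightarrow> 'b) \<Rightarrow> 'a \<Rightarrow> 'b" where
  "scaleR_fun c f = (\<lambda>x. c *\<^sub>R f x)"

instance
  by standard (simp_all add: scaleR_fun_def fun_eq_iff scaleR_add_right scaleR_add_left)

end

type_synonym 'g vfield = "('g \<Rightarrow> real) \<Rightarrow> 'g \<Rightarrow> real"

text \<open>Vector fields are derivations of \<open>C\<^sup>\<infinity>(G)\<close>, extended by \<open>0\<close> to the
  functions that are not smooth.\<close>

definition lie_algebra ::
  "('g::topological_space) monoid \<Rightarrow> ('g, 'e::euclidean_space) chart set \<Rightarrow> 'g vfield set" where
  "lie_algebra G A = {X.
     (\<forall>f. f \<notin> smooth_functions A \<longrightarrow> X f = 0) \<and>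
     (\<forall>f\<in>smooth_functions A. X f \<in> smooth_functions A) \<and>
     (\<forall>f\<in>smooth_functions A. \<forall>h\<in>smooth_functions A. X (f + h) = X f + X h) \<and>
     (\<forall>c. \<forall>f\<in>smooth_functions A. X (c *\<^sub>R f) = c *\<^sub>R X f) \<and>
     (\<forall>f\<in>smooth_functions A. \<forall>h\<in>smooth_functions A. X (f * h) = X f * h + f * X h) \<and>
     (\<forall>a. \<forall>f\<in>smooth_functions A. X (\<lambda>x. f (a \<otimes>\<^bsub>G\<^esub> x)) = (\<lambda>x. X f (a \<otimes>\<^bsub>G\<^esub> x)))}"

definition lie_bracket :: "'g vfield \<Rightarrow> 'g vfield \<Rightarrow> 'g vfield" where
  "lie_bracket X Y = (\<lambda>f. X (Y f) - Y (X f))"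


section \<open>Carnot groups\<close>

definition stratification :: "'g vfield set \<Rightarrow> (nat \<Rightarrow> 'g vfield set) \<Rightarrow> nat \<Rightarrow> bool" where
  "stratification L V s \<longleftrightarrow>
     1 \<le> s \<and> is_direct_sum scaleR {1..s} V L \<and>
     (\<forall>i\<ge>1. span {lie_bracket X Y | X Y. X \<in> V 1 \<and> Y \<in> V i} = V (Suc i)) \<and>
     V s \<noteq> {0} \<and> (\<forall>k>s. V k = {0})"

definition carnot_group ::
  "('g::{t2_space, second_countable_topology}) monoid \<Rightarrow> ('g, 'e::euclidean_space) chart set \<Rightarrow>
   (nat \<Rightarrow> 'g vfield set) \<Rightarrow> nat \<Rightarrow> bool" where
  "carnot_group G A V s \<longleftrightarrow>
     lie_group G A \<and> connected (UNIV :: 'g set) \<and> simply_connected (UNIV :: 'g set) \<and>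
     stratification (lie_algebra G A) V s"

definition inner_product_on :: "'v::real_vector set \<Rightarrow> ('v \<Rightarrow> 'v \<Rightarrow> real) \<Rightarrow> bool" where
  "inner_product_on L ip \<longleftrightarrow>
     (\<forall>x\<in>L. \<forall>y\<in>L. ip x y = ip y x) \<and>
     (\<forall>x\<in>L. \<forall>y\<in>L. \<forall>z\<in>L. ip (x + y) z = ip x z + ip y z) \<and>
     (\<forall>c. \<forall>x\<in>L. \<forall>y\<in>L. ip (c *\<^sub>R x) y = c * ip x y) \<and>
     (\<forall>x\<in>L. x \<noteq> 0 \<longrightarrow> ip x x > 0)"

definition adapted_orthonormal_basis ::
  "'v::real_vector set \<Rightarrow> (nat \<Rightarrow> 'v set) \<Rightarrow> nat \<Rightarrow> ('v \<Rightarrow> 'v \<Rightarrow> real) \<Rightarrow> nat \<Rightarrow> (nat \<Rightarrow> 'v) \<Rightarrow> bool"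
where
  "adapted_orthonormal_basis L V s ip n X \<longleftrightarrow>
     inj_on X {1..n} \<and> independent (X ` {1..n}) \<and> span (X ` {1..n}) = L \<and>
     (\<forall>j\<in>{1..n}. \<exists>i\<in>{1..s}. X j \<in> V i) \<and>
     inner_product_on L ip \<and>
     (\<forall>i\<in>{1..s}. \<forall>k\<in>{1..s}. i \<noteq> k \<longrightarrow> (\<forall>x\<in>V i. \<forall>y\<in>V k. ip x y = 0)) \<and>
     (\<forall>i\<in>{1..n}. \<forall>j\<in>{1..n}. ip (X i) (X j) = (if i = j then 1 else 0))"


section \<open>Covectors and their weights\<close>

text \<open>An \<open>h\<close>-covector is a function of the list of its \<open>h\<close> arguments, extended by \<open>0\<close> to
  all other lists. Thus covectors of all degrees live in one vector space, and they can be added.\<close>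

type_synonym 'v covector = "'v list \<Rightarrow> real"

definition alternating_covectors :: "'v::real_vector set \<Rightarrow> nat \<Rightarrow> 'v covector set" where
  "alternating_covectors L h = {\<omega>.
     (\<forall>Ys. \<not> (length Ys = h \<and> set Ys \<subseteq> L) \<longrightarrow> \<omega> Ys = 0) \<and>
     (\<forall>Ys k Y Z. length Ys = h \<and> set Ys \<subseteq> L \<and> k < h \<and> Y \<in> L \<and> Z \<in> L \<longrightarrow>
        \<omega> (Ys[k := Y + Z]) = \<omega> (Ys[k := Y]) + \<omega> (Ys[k := Z])) \<and>
     (\<forall>Ys k Y c. length Ys = h \<and> set Ys \<subseteq> L \<and> k < h \<and> Y \<in> L \<longrightarrow>
        \<omega> (Ys[k := c *\<^sub>R Y]) = c * \<omega> (Ys[k := Y])) \<and>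
     (\<forall>Ys. length Ys = h \<and> set Ys \<subseteq> L \<and> \<not> distinct Ys \<longrightarrow> \<omega> Ys = 0)}"

text \<open>\<open>representation\<close> vanishes outside the span of the basis, so these functionals, and with them
  wedge products of positive degree, vanish on arguments outside the Lie algebra.\<close>

definition dual_basis :: "nat \<Rightarrow> (nat \<Rightarrow> 'v::real_vector) \<Rightarrow> nat \<Rightarrow> 'v \<Rightarrow> real" where
  "dual_basis n X j Y = representation (X ` {1..n}) Y (X j)"

definition wedge :: "('v \<Rightarrow> real) list \<Rightarrow> 'v covector" where
  "wedge \<eta>s Ys =
     (if length Ys = length \<eta>s
      then \<Sum>\<sigma> | \<sigma> permutes {..<length \<eta>s}.
             of_int (sign \<sigma>) * (\<Prod>i<length \<eta>s. (\<eta>s ! i) (Ys ! \<sigma> i))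
      else 0)"

definition weight :: "(nat \<Rightarrow> 'v set) \<Rightarrow> (nat \<Rightarrow> 'v) \<Rightarrow> nat \<Rightarrow> nat" where
  "weight V X j = (THE i. 1 \<le> i \<and> X j \<in> V i)"

definition weighted_covectors ::
  "(nat \<Rightarrow> 'v::real_vector set) \<Rightarrow> nat \<Rightarrow> (nat \<Rightarrow> 'v) \<Rightarrow> int \<times> int \<Rightarrow> 'v covector set" where
  "weighted_covectors V n X = (\<lambda>(a, b).
     span {wedge (map (dual_basis n X) J) | J.
       set J \<subseteq> {1..n} \<and> int (length J) = a + b \<and> int (\<Sum>j\<leftarrow>J. weight V X j) = a})"


section \<open>Differential forms\<close>

text \<open>Via left-invariant forms, the smooth forms on the group are
  \<open>\<Lambda>\<^sup>h \<gg>\<^sup>* \<otimes> C\<^sup>\<infinity>(G)\<close>. Since the Lie algebra \<open>\<gg>\<close> is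
  finite-dimensional, this tensor product is the space of functions on lists of left-invariant
  vector fields, with values in \<open>C\<^sup>\<infinity>(G)\<close>, that is spanned by the products
  \<open>\<omega> \<otimes> f\<close>.\<close>

type_synonym 'g dform = "'g vfield list \<Rightarrow> 'g \<Rightarrow> real"

definition tensor_smooth ::
  "('g::topological_space, 'e::euclidean_space) chart set \<Rightarrow> 'g vfield covector set \<Rightarrow> 'g dform set"
where
  "tensor_smooth A W = span {(\<lambda>Ys. \<omega> Ys *\<^sub>R f) | \<omega> f. \<omega> \<in> W \<and> f \<in> smooth_functions A}"

definition forms ::
  "('g::topological_space) monoid \<Rightarrow> ('g, 'e::euclidean_space) chart set \<Rightarrow> nat \<Rightarrow> 'g dform set" where
  "forms G A h = tensor_smooth A (alternating_covectors (lie_algebra G A) h)"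

definition all_forms ::
  "('g::topological_space) monoid \<Rightarrow> ('g, 'e::euclidean_space) chart set \<Rightarrow> 'g dform set" where
  "all_forms G A = span (\<Union>h. forms G A h)"

definition weighted_forms ::
  "('g::topological_space, 'e::euclidean_space) chart set \<Rightarrow> (nat \<Rightarrow> 'g vfield set) \<Rightarrow> nat \<Rightarrow>
   (nat \<Rightarrow> 'g vfield) \<Rightarrow> int \<times> int \<Rightarrow> 'g dform set" where
  "weighted_forms A V n X p = tensor_smooth A (weighted_covectors V n X p)"

text \<open>The exterior derivative, given by its invariant formula
  \<open>d\<alpha>(Y\<^sub>0, \<dots>, Y\<^sub>h) = \<Sum>\<^sub>i (-1)\<^sup>i Y\<^sub>i(\<alpha>(\<dots>, omit Y\<^sub>i, \<dots>))
    + \<Sum>\<^sub>i\<^sub><\<^sub>j (-1)\<^sup>i\<^sup>+\<^sup>j \<alpha>([Y\<^sub>i, Y\<^sub>j], \<dots>, omit Y\<^sub>i, Y\<^sub>j, \<dots>)\<close>.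
  Left-invariant vector fields form a global frame, so their values determine \<open>d\<alpha>\<close>.\<close>

definition ext_deriv ::
  "('g::topological_space) monoid \<Rightarrow> ('g, 'e::euclidean_space) chart set \<Rightarrow> 'g dform \<Rightarrow> 'g dform" where
  "ext_deriv G A \<alpha> Ys =
     (if set Ys \<subseteq> lie_algebra G A
      then (\<Sum>i<length Ys. (- 1) ^ i *\<^sub>R (Ys ! i) (\<alpha> (nths Ys (- {i})))) +
           (\<Sum>(i, j) | i < j \<and> j < length Ys.
              (- 1) ^ (i + j) *\<^sub>R \<alpha> (lie_bracket (Ys ! i) (Ys ! j) # nths Ys (- {i, j})))
      else 0)"

definition weight_part :: "(int \<times> int \<Rightarrow> 'c::comm_monoid_add set) \<Rightarrow> int \<Rightarrow> 'c \<Rightarrow> 'c" where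
  "weight_part M p x = family_sum (\<lambda>b. component M (p, b) x)"

text \<open>The part of \<open>d\<close> that raises the weight by \<open>i\<close>: on each summand of pure weight
  \<open>p\<close> it takes the component of \<open>d x\<close> of weight \<open>p + i\<close>.\<close>

definition raising_part ::
  "(int \<times> int \<Rightarrow> 'c::comm_monoid_add set) \<Rightarrow> ('c \<Rightarrow> 'c) \<Rightarrow> nat \<Rightarrow> 'c \<Rightarrow> 'c" where
  "raising_part M d i x =
     (\<Sum>p | weight_part M p x \<noteq> 0. weight_part M (p + int i) (d (weight_part M p x)))"

definition d_part ::
  "('g::topological_space) monoid \<Rightarrow> ('g, 'e::euclidean_space) chart set \<Rightarrow>
   (nat \<Rightarrow> 'g vfield set) \<Rightarrow> nat \<Rightarrow> (nat \<Rightarrow> 'g vfield) \<Rightarrow> nat \<Rightarrow> 'g dform \<Rightarrow> 'g dform" where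
  "d_part G A V n X = raising_part (weighted_forms A V n X) (ext_deriv G A)"

end

theory Submission
  imports Defs
begin

text \<open>
  The theorem is what two properties of the exterior derivative \<open>d\<close> say weight by weight:
  \<open>d d = 0\<close>, and \<open>d\<close> raises the weight of a form by at least \<open>0\<close> and at most \<open>s\<close>. On a form of
  weight \<open>a\<close>, the sum of all \<open>d\<^sub>i d\<^sub>j\<close> with \<open>i + j = n\<close> is the part of weight \<open>a + n\<close> of \<open>d d\<close>, hence
  zero; no contribution is lost because \<open>d\<close> never lowers the weight. This argument is carried out
  for an arbitrary bigraded space in the locale \<open>weighted_differential\<close>.

  Apart from the linearity of \<open>d\<close>, its invariant formula is used for one consequence, Cartan's formula
  \<open>\<iota>\<^sub>Y d = \<L>\<^sub>Y - d \<iota>\<^sub>Y\<close> (lemma \<open>contract_d\<close>), in which \<open>\<iota>\<^sub>Y\<close> is the contraction with \<open>Y\<close>. The Lie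
  derivative satisfies \<open>\<iota>\<^sub>Z \<L>\<^sub>Y = \<L>\<^sub>Y \<iota>\<^sub>Z - \<iota>\<^bsub>[Y,Z]\<^esub>\<close>. Two forms agree when all their contractions
  and their values on the empty list agree, so both rules together allow induction on the number of
  arguments. In this way \<open>d\<close> maps alternating forms to alternating forms (\<open>d_form\<close>), the Jacobi identity gives
  \<open>[\<L>\<^sub>Y, \<L>\<^sub>Z] = \<L>\<^bsub>[Y,Z]\<^esub>\<close> (\<open>lie_derivative_commutator\<close>), then \<open>d\<close> commutes with \<open>\<L>\<^sub>Y\<close>
  (\<open>d_lie_derivative\<close>), and finally \<open>\<iota>\<^sub>Y d d = \<L>\<^sub>Y d - d \<L>\<^sub>Y + d d \<iota>\<^sub>Y = d d \<iota>\<^sub>Y\<close> gives \<open>d d = 0\<close> (\<open>d_d\<close>).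

  The decomposition into weights comes from the expansion \<open>\<alpha> = 1/h! \<Sum>\<^sub>J \<alpha>(X\<^sub>J) \<theta>\<^sub>J\<close> of an \<open>h\<close>-form
  over all lists \<open>J\<close> of \<open>h\<close> indices (\<open>wedge_expansion\<close>). Keeping only the lists of a given weight
  defines a projection, and a family of such projections makes the sum direct
  (\<open>graded_projections\<close>). A form has weight \<open>a\<close> only if it vanishes on the frame vectors \<open>X\<^sub>K\<close>
  for every \<open>K\<close> of another weight.

  It remains to evaluate \<open>d \<alpha>\<close> on \<open>X\<^sub>K\<close> for \<open>\<alpha>\<close> of weight \<open>a\<close>. A term that differentiates along
  \<open>X\<^sub>k\<close> needs \<open>K\<close> of weight \<open>a + w k\<close> with \<open>1 \<le> w k \<le> s\<close>. A term that inserts a bracket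
  \<open>[X\<^sub>j, X\<^sub>k]\<close> needs \<open>K\<close> of weight \<open>a\<close>, because \<open>[V\<^sub>p, V\<^sub>q] \<subseteq> V\<^bsub>p+q\<^esub>\<close> (\<open>lie_bracket_layers\<close>) and
  because the dual covectors of one weight vanish on the layers of all other weights
  (\<open>dual_layer\<close>). So \<open>d \<alpha>\<close> lives in the weights from \<open>a\<close> to \<open>a + s\<close> (\<open>pure_weight_d\<close>).
\<close>

section \<open>Alternating covectors\<close>

lemma sum_fun_apply: "(\<Sum>i\<in>I. f i) x = (\<Sum>i\<in>I. f i x)"
  by (induction I rule: infinite_finite_induct) simp_all

text \<open>The interior product \<open>\<iota>\<^sub>Y\<close>. The value type is arbitrary, so that it acts on real covectors and on
  function-valued forms alike.\<close>

definition contract :: "'v \<Rightarrow> ('v list \<Rightarrow> 'b) \<Rightarrow> 'v list \<Rightarrow> 'b" where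
  "contract Y \<alpha> Zs = \<alpha> (Y # Zs)"

lemma alternatingI:
  assumes "\<And>Ys. \<not> (length Ys = h \<and> set Ys \<subseteq> L) \<Longrightarrow> \<omega> Ys = 0"
    and "\<And>Ys k Y Z. \<lbrakk>length Ys = h; set Ys \<subseteq> L; k < h; Y \<in> L; Z \<in> L\<rbrakk> \<Longrightarrow>
        \<omega> (Ys[k := Y + Z]) = \<omega> (Ys[k := Y]) + \<omega> (Ys[k := Z])"
    and "\<And>Ys k Y c. \<lbrakk>length Ys = h; set Ys \<subseteq> L; k < h; Y \<in> L\<rbrakk> \<Longrightarrow>
        \<omega> (Ys[k := c *\<^sub>R Y]) = c * \<omega> (Ys[k := Y])"
    and "\<And>Ys. \<lbrakk>length Ys = h; set Ys \<subseteq> L; \<not> distinct Ys\<rbrakk> \<Longrightarrow> \<omega> Ys = 0"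
  shows "\<omega> \<in> alternating_covectors L h"
  using assms unfolding alternating_covectors_def by blast

lemma alternatingD:
  assumes "\<omega> \<in> alternating_covectors L h"
  shows "\<not> (length Ys = h \<and> set Ys \<subseteq> L) \<Longrightarrow> \<omega> Ys = 0"
    and "\<lbrakk>length Ys = h; set Ys \<subseteq> L; k < h; Y \<in> L; Z \<in> L\<rbrakk> \<Longrightarrow>
        \<omega> (Ys[k := Y + Z]) = \<omega> (Ys[k := Y]) + \<omega> (Ys[k := Z])"
    and "\<lbrakk>length Ys = h; set Ys \<subseteq> L; k < h; Y \<in> L\<rbrakk> \<Longrightarrow>
        \<omega> (Ys[k := c *\<^sub>R Y]) = c * \<omega> (Ys[k := Y])"
    and "\<lbrakk>length Ys = h; set Ys \<subseteq> L; \<not> distinct Ys\<rbrakk> \<Longrightarrow> \<omega> Ys = 0"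
  using assms unfolding alternating_covectors_def by blast+

lemma subspace_alternating_covectors: "subspace (alternating_covectors L h)"
  unfolding subspace_def
proof (intro conjI ballI allI)
  show "0 \<in> alternating_covectors L h"
    by (rule alternatingI) simp_all
next
  fix \<omega> \<eta> assume *: "\<omega> \<in> alternating_covectors L h" "\<eta> \<in> alternating_covectors L h"
  show "\<omega> + \<eta> \<in> alternating_covectors L h"
    by (rule alternatingI)
      (simp_all add: alternatingD[OF *(1)] alternatingD[OF *(2)] algebra_simps)
next
  fix c \<omega> assume *: "\<omega> \<in> alternating_covectors L h"
  show "c *\<^sub>R \<omega> \<in> alternating_covectors L h"
    by (rule alternatingI)
      (simp_all add: scaleR_fun_def alternatingD[OF *] algebra_simps)
qed

text \<open>On a \<open>0\<close>-covector the contraction is \<open>0\<close>, which belongs to every degree; this makes the truncated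
  subtraction harmless and spares a case distinction in later inductions.\<close>

lemma alternating_contract:
  assumes "\<omega> \<in> alternating_covectors L h" "Y \<in> L"
  shows "contract Y \<omega> \<in> alternating_covectors L (h - 1)"
proof (cases h)
  case 0
  have "contract Y \<omega> = 0"
    using alternatingD(1)[OF assms(1)] 0 by (auto simp: contract_def fun_eq_iff)
  then show ?thesis
    using subspace_0[OF subspace_alternating_covectors] by simp
next
  case (Suc m)
  note a = alternatingD[OF assms(1)]
  show ?thesis
  proof (rule alternatingI)
    fix Ys assume "\<not> (length Ys = h - 1 \<and> set Ys \<subseteq> L)"
    then show "contract Y \<omega> Ys = 0" using a(1)[of "Y # Ys"] Suc by (simp add: contract_def)
  next
    fix Ys k Z W assume "length Ys = h - 1" "set Ys \<subseteq> L" "k < h - 1" "Z \<in> L" "W \<in> L"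
    then show "contract Y \<omega> (Ys[k := Z + W]) = contract Y \<omega> (Ys[k := Z]) + contract Y \<omega> (Ys[k := W])"
      using a(2)[of "Y # Ys" "Suc k" Z W] Suc \<open>Y \<in> L\<close> by (simp add: contract_def)
  next
    fix Ys k Z c assume "length Ys = h - 1" "set Ys \<subseteq> L" "k < h - 1" "Z \<in> L"
    then show "contract Y \<omega> (Ys[k := c *\<^sub>R Z]) = c * contract Y \<omega> (Ys[k := Z])"
      using a(3)[of "Y # Ys" "Suc k" Z c] Suc \<open>Y \<in> L\<close> by (simp add: contract_def)
  next
    fix Ys assume "length Ys = h - 1" "set Ys \<subseteq> L" "\<not> distinct Ys"
    then show "contract Y \<omega> Ys = 0" using a(4)[of "Y # Ys"] Suc \<open>Y \<in> L\<close> by (simp add: contract_def)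
  qed
qed

lemma alternating_head_add:
  assumes "\<omega> \<in> alternating_covectors L h" "subspace L" "Y \<in> L" "Z \<in> L"
  shows "\<omega> ((Y + Z) # Ws) = \<omega> (Y # Ws) + \<omega> (Z # Ws)"
proof (cases "Suc (length Ws) = h \<and> set Ws \<subseteq> L")
  case True
  then show ?thesis
    using alternatingD(2)[OF assms(1), of "Y # Ws" 0 Y Z] assms by simp
next
  case False
  then show ?thesis
    using alternatingD(1)[OF assms(1), of "U # Ws" for U] by simp
qed

lemma alternating_head_scale:
  assumes "\<omega> \<in> alternating_covectors L h" "subspace L" "Y \<in> L"
  shows "\<omega> ((c *\<^sub>R Y) # Ws) = c * \<omega> (Y # Ws)"
proof (cases "Suc (length Ws) = h \<and> set Ws \<subseteq> L")
  case True
  then show ?thesis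
    using alternatingD(3)[OF assms(1), of "Y # Ws" 0 Y c] assms by simp
next
  case False
  then show ?thesis
    using alternatingD(1)[OF assms(1), of "U # Ws" for U] by simp
qed

lemma alternating_head_sum:
  assumes "\<omega> \<in> alternating_covectors L h" "subspace L" "\<And>i. i \<in> I \<Longrightarrow> Y i \<in> L"
  shows "\<omega> ((\<Sum>i\<in>I. c i *\<^sub>R Y i) # Ws) = (\<Sum>i\<in>I. c i * \<omega> (Y i # Ws))"
  using assms(3)
proof (induction I rule: infinite_finite_induct)
  case (insert x F)
  have "(\<Sum>i\<in>F. c i *\<^sub>R Y i) \<in> L"
    using insert assms(2) by (intro subspace_sum subspace_scale) auto
  with insert show ?case
    using assms(1,2) by (simp add: alternating_head_add alternating_head_scale subspace_scale)
qed (use alternating_head_scale[OF assms(1,2) subspace_0[OF assms(2)], of 0 Ws] in simp_all)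

lemma alternating_twice:
  assumes "\<omega> \<in> alternating_covectors L h" "Y \<in> L"
  shows "\<omega> (Y # Y # Ws) = 0"
  using alternatingD(1,4)[OF assms(1), of "Y # Y # Ws"] by (cases "length (Y # Y # Ws) = h \<and> set (Y # Y # Ws) \<subseteq> L") auto

lemma alternating_swap:
  assumes "\<omega> \<in> alternating_covectors L h" "subspace L" "Y \<in> L" "Z \<in> L"
  shows "\<omega> (Y # Z # Ws) = - \<omega> (Z # Y # Ws)"
proof -
  note add = alternating_head_add[OF assms(1,2)]
  have 1: "\<omega> (U # (Y + Z) # Ws) = \<omega> (U # Y # Ws) + \<omega> (U # Z # Ws)" if "U \<in> L" for U
    using alternating_head_add[OF alternating_contract[OF assms(1) that] assms(2-4)]
    by (simp add: contract_def)
  have "0 = \<omega> ((Y + Z) # (Y + Z) # Ws)"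
    using alternating_twice[OF assms(1)] assms subspace_add by metis
  also have "\<dots> = \<omega> (Y # Z # Ws) + \<omega> (Z # Y # Ws)"
    using assms 1 by (simp add: add alternating_twice[OF assms(1)])
  finally show ?thesis by simp
qed

text \<open>The recursive description of alternating covectors that drives all inductions on the degree. Only
  a repetition in the first two places has to be excluded by hand: by polarisation the first two
  arguments anticommute, and a repetition elsewhere is moved into a contraction, which is
  alternating already.\<close>

lemma alternating_SucI:
  assumes L: "subspace L"
    and nil: "\<omega> [] = 0"
    and out: "\<And>Y. Y \<notin> L \<Longrightarrow> contract Y \<omega> = 0"
    and alt: "\<And>Y. Y \<in> L \<Longrightarrow> contract Y \<omega> \<in> alternating_covectors L h"
    and add: "\<And>Y Z. Y \<in> L \<Longrightarrow> Z \<in> L \<Longrightarrow> contract (Y + Z) \<omega> = contract Y \<omega> + contract Z \<omega>"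
    and scale: "\<And>Y c. Y \<in> L \<Longrightarrow> contract (c *\<^sub>R Y) \<omega> = c *\<^sub>R contract Y \<omega>"
    and twice: "\<And>Y. Y \<in> L \<Longrightarrow> contract Y (contract Y \<omega>) = 0"
  shows "\<omega> \<in> alternating_covectors L (Suc h)"
proof -
  have add': "\<omega> ((Y + Z) # Ws) = \<omega> (Y # Ws) + \<omega> (Z # Ws)" if "Y \<in> L" "Z \<in> L" for Y Z Ws
    using add[OF that] by (simp add: contract_def fun_eq_iff)
  have twice': "\<omega> (Y # Y # Ws) = 0" if "Y \<in> L" for Y Ws
    using twice[OF that] by (simp add: contract_def fun_eq_iff)
  \<comment> \<open>Polarisation: expand the value on \<open>(Y + Z, Y + Z, \<dots>)\<close>, which is zero.\<close>
  have swap: "\<omega> (Y # Z # Ws) = - \<omega> (Z # Y # Ws)" if YZ: "Y \<in> L" "Z \<in> L" for Y Z Ws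
  proof -
    have 1: "\<omega> (U # (Y + Z) # Ws) = \<omega> (U # Y # Ws) + \<omega> (U # Z # Ws)" if "U \<in> L" for U
      using alternating_head_add[OF alt[OF that] L YZ] by (simp add: contract_def)
    have "0 = \<omega> ((Y + Z) # (Y + Z) # Ws)"
      using twice'[OF subspace_add[OF L YZ]] by simp
    also have "\<dots> = \<omega> (Y # Z # Ws) + \<omega> (Z # Y # Ws)"
      using YZ by (simp add: add' 1 twice')
    finally show ?thesis by simp
  qed
  have repeat: "\<omega> (Y # vs @ Y # ws) = 0" if "Y \<in> L" "set vs \<subseteq> L" "set ws \<subseteq> L" "length vs + length ws + 1 = h" for Y vs ws
  proof (cases vs)
    case Nil
    then show ?thesis using twice' that by simp
  next
    case (Cons v vs')
    have "\<omega> (Y # v # vs' @ Y # ws) = - contract v \<omega> (Y # vs' @ Y # ws)"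
      unfolding contract_def using that Cons by (intro swap) auto
    also have "\<dots> = 0"
      using alternatingD(4)[OF alt, of v "Y # vs' @ Y # ws"] that Cons by auto
    finally show ?thesis using Cons by simp
  qed
  show ?thesis
  proof (rule alternatingI)
    fix Ys assume *: "\<not> (length Ys = Suc h \<and> set Ys \<subseteq> L)"
    show "\<omega> Ys = 0"
    proof (cases Ys)
      case (Cons Y Zs)
      then show ?thesis
        using out[of Y] alternatingD(1)[OF alt[of Y], of Zs] *
        by (cases "Y \<in> L") (auto simp: contract_def fun_eq_iff)
    qed (simp add: nil)
  next
    fix Ys k Y Z assume *: "length Ys = Suc h" "set Ys \<subseteq> L" "k < Suc h" "Y \<in> L" "Z \<in> L"
    then show "\<omega> (Ys[k := Y + Z]) = \<omega> (Ys[k := Y]) + \<omega> (Ys[k := Z])"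
      using alternatingD(2)[OF alt[of "hd Ys"], of "tl Ys" "k - 1" Y Z] add'
      by (cases Ys; cases k) (auto simp: contract_def)
  next
    fix Ys k Y c assume *: "length Ys = Suc h" "set Ys \<subseteq> L" "k < Suc h" "Y \<in> L"
    then show "\<omega> (Ys[k := c *\<^sub>R Y]) = c * \<omega> (Ys[k := Y])"
      using alternatingD(3)[OF alt[of "hd Ys"], of "tl Ys" "k - 1" Y c] scale[of Y c]
      by (cases Ys; cases k) (auto simp: contract_def fun_eq_iff scaleR_fun_def)
  next
    fix Ys assume *: "length Ys = Suc h" "set Ys \<subseteq> L" "\<not> distinct Ys"
    then obtain Y Zs where Y: "Ys = Y # Zs" by (cases Ys) auto
    show "\<omega> Ys = 0"
    proof (cases "distinct Zs")
      case True
      then obtain vs ws where "Zs = vs @ Y # ws"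
        using * Y by (auto dest: split_list)
      then show ?thesis using repeat * Y by auto
    next
      case False
      then show ?thesis using alternatingD(4)[OF alt[of Y], of Zs] * Y by (auto simp: contract_def)
    qed
  qed
qed

lemma alternating_transpose:
  assumes "\<omega> \<in> alternating_covectors L h" "subspace L" "length Ys = h" "set Ys \<subseteq> L"
    and ab: "a < h" "b < h" "a \<noteq> b"
  shows "\<omega> (permute_list (Transposition.transpose a b) Ys) = - \<omega> Ys"
proof -
  note D = alternatingD[OF assms(1)]
  define g where "g u v = \<omega> (Ys[a := u, b := v])" for u v
  have in_L: "Ys ! a \<in> L" "Ys ! b \<in> L" using assms nth_mem by blast+
  have upd: "set (Ys[k := u]) \<subseteq> L" if "u \<in> L" for k u
    using assms(4) that set_update_subset_insert by fastforce
  have upd2: "set (Ys[a := u, b := v]) \<subseteq> L" if "u \<in> L" "v \<in> L" for u v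
    using upd[OF that(1), of a] that(2) set_update_subset_insert by fastforce
  have g2: "g u (v + w) = g u v + g u w" if "u \<in> L" "v \<in> L" "w \<in> L" for u v w
    using D(2)[of "Ys[a := u]" b v w] that upd assms by (simp add: g_def)
  have g1: "g (v + w) u = g v u + g w u" if "u \<in> L" "v \<in> L" "w \<in> L" for u v w
    using D(2)[of "Ys[b := u]" a v w] that upd assms by (simp add: g_def list_update_swap)
  have g0: "g u u = 0" if "u \<in> L" for u
  proof -
    have "\<not> distinct (Ys[a := u, b := u])"
      using ab assms(3) nth_eq_iff_index_eq[of "Ys[a := u, b := u]" a b] by auto
    then show ?thesis using D(4) upd2 that assms(3) by (simp add: g_def)
  qed
  let ?u = "Ys ! a" and ?v = "Ys ! b"
  have "?u + ?v \<in> L" using in_L assms(2) subspace_add by blast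
  then have "0 = g (?u + ?v) (?u + ?v)" using g0 by simp
  also have "\<dots> = (g ?u ?u + g ?v ?u) + (g ?u ?v + g ?v ?v)"
    using in_L \<open>?u + ?v \<in> L\<close> by (simp only: g1 g2)
  also have "\<dots> = g ?u ?v + g ?v ?u"
    using in_L by (simp add: g0)
  finally have "g ?v ?u = - g ?u ?v" by simp
  moreover have "Ys[a := ?u, b := ?v] = Ys" by (simp add: list_update_id)
  moreover have "permute_list (Transposition.transpose a b) Ys = Ys[a := ?v, b := ?u]"
    using ab assms(3)
    by (intro nth_equalityI) (auto simp: permute_list_def nth_list_update transpose_def)
  ultimately show ?thesis by (simp add: g_def)
qed

text \<open>A permutation is a product of transpositions, and each of them changes the sign, by
  polarisation in the two places concerned.\<close>

lemma alternating_permute: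
  assumes "\<omega> \<in> alternating_covectors L h" "subspace L" "length Ys = h" "set Ys \<subseteq> L"
    and "\<sigma> permutes {..<h}"
  shows "\<omega> (permute_list \<sigma> Ys) = of_int (sign \<sigma>) * \<omega> Ys"
  using assms(5) finite_lessThan assms(3,4)
proof (induction arbitrary: Ys rule: permutes_induct)
  case id
  then show ?case by (simp add: sign_id)
next
  case (swap a b p)
  let ?\<tau> = "Transposition.transpose a b"
  have \<tau>: "?\<tau> permutes {..<h}" using swap by (intro permutes_swap_id) auto
  have "\<omega> (permute_list (?\<tau> \<circ> p) Ys) = \<omega> (permute_list p (permute_list ?\<tau> Ys))"
    using swap by (simp add: permute_list_compose)
  also have "\<dots> = of_int (sign p) * \<omega> (permute_list ?\<tau> Ys)"
    using swap \<tau> by (intro swap.IH) (auto simp: set_permute_list)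
  also have "\<dots> = - of_int (sign p) * \<omega> Ys"
    using alternating_transpose[OF assms(1,2)] swap by auto
  also have "- of_int (sign p) = (of_int (sign (?\<tau> \<circ> p)) :: real)"
    using swap by (subst sign_compose)
      (auto simp: sign_swap_id permutation_swap_id intro: permutes_imp_permutation[of "{..<h}"])
  finally show ?case .
qed

section \<open>Expansion in wedge products of a dual basis\<close>

definition index_lists :: "nat \<Rightarrow> nat \<Rightarrow> nat list set" where
  "index_lists n h = {J. set J \<subseteq> {1..n} \<and> length J = h}"

lemma finite_index_lists: "finite (index_lists n h)"
  unfolding index_lists_def by (rule finite_lists_length_eq) simp

lemma index_lists_0: "index_lists n 0 = {[]}"
  by (auto simp: index_lists_def)

lemma index_lists_Suc: "index_lists n (Suc h) = (\<lambda>(j, J). j # J) ` ({1..n} \<times> index_lists n h)"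
    by (auto simp: index_lists_def length_Suc_conv image_iff)

lemma sum_index_lists_Suc:
  "(\<Sum>J\<in>index_lists n (Suc h). f J) = (\<Sum>j\<in>{1..n}. \<Sum>J\<in>index_lists n h. f (j # J))"
proof -
  have "inj_on (\<lambda>(j, J). j # J) ({1..n} \<times> index_lists n h)"
    by (rule inj_onI) (clarsimp)
  then have "(\<Sum>J\<in>index_lists n (Suc h). f J) = (\<Sum>(j, J)\<in>{1..n} \<times> index_lists n h. f (j # J))"
    unfolding index_lists_Suc by (subst sum.reindex) (simp_all add: case_prod_unfold)
  also have "\<dots> = (\<Sum>j\<in>{1..n}. \<Sum>J\<in>index_lists n h. f (j # J))"
    by (rule sum.cartesian_product[symmetric])
  finally show ?thesis .
qed

locale finite_frame =
  fixes L :: "'v::real_vector set" and n :: nat and X :: "nat \<Rightarrow> 'v"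
  assumes inj: "inj_on X {1..n}" and indep: "independent (X ` {1..n})"
    and span_eq: "span (X ` {1..n}) = L"
begin

abbreviation "\<theta> \<equiv> dual_basis n X"

lemma subspace_L: "subspace L"
  using span_eq subspace_span by metis

lemma frame_in: "j \<in> {1..n} \<Longrightarrow> X j \<in> L"
  using span_eq span_base[of "X j" "X ` {1..n}"] by simp

lemma dual_frame:
  assumes "j \<in> {1..n}" "k \<in> {1..n}"
  shows "\<theta> j (X k) = (if j = k then 1 else 0)"
proof -
  have "representation (X ` {1..n}) (X k) = (\<lambda>v. if v = X k then 1 else 0)"
    using assms by (intro representation_basis indep) auto
  then show ?thesis
    using inj_onD[OF inj] assms by (auto simp: dual_basis_def)
qed

lemma dual_add: "Y \<in> L \<Longrightarrow> Z \<in> L \<Longrightarrow> \<theta> j (Y + Z) = \<theta> j Y + \<theta> j Z"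
  using indep span_eq by (simp add: dual_basis_def representation_add)

lemma dual_scale: "Y \<in> L \<Longrightarrow> \<theta> j (c *\<^sub>R Y) = c * \<theta> j Y"
  using indep span_eq by (simp add: dual_basis_def representation_scale)

lemma dual_outside: "Y \<notin> L \<Longrightarrow> \<theta> j Y = 0"
  unfolding dual_basis_def by (metis representation_def span_eq)

lemma frame_expansion: "Y \<in> L \<Longrightarrow> Y = (\<Sum>j\<in>{1..n}. \<theta> j Y *\<^sub>R X j)"
proof -
  assume "Y \<in> L"
  then have "(\<Sum>b\<in>X ` {1..n}. representation (X ` {1..n}) Y b *\<^sub>R b) = Y"
    using indep span_eq by (intro sum_representation_eq) auto
  then show ?thesis using inj by (simp add: sum.reindex dual_basis_def)
qed

lemma orthonormal_dual:
  assumes ip: "inner_product_on L ip"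
    and orthonormal: "\<And>i j. i \<in> {1..n} \<Longrightarrow> j \<in> {1..n} \<Longrightarrow> ip (X i) (X j) = (if i = j then 1 else 0)"
    and Z: "Z \<in> L" and l: "l \<in> {1..n}"
  shows "ip Z (X l) = \<theta> l Z"
proof -
  note Xl = frame_in[OF l]
  have add: "ip (x + y) (X l) = ip x (X l) + ip y (X l)" if "x \<in> L" "y \<in> L" for x y
    using ip that Xl by (simp add: inner_product_on_def)
  have scale: "ip (c *\<^sub>R x) (X l) = c * ip x (X l)" if "x \<in> L" for c x
    using ip that Xl by (simp add: inner_product_on_def)
  have "(\<Sum>j\<in>T. \<theta> j Z *\<^sub>R X j) \<in> L \<and>
      ip (\<Sum>j\<in>T. \<theta> j Z *\<^sub>R X j) (X l) = (\<Sum>j\<in>T. \<theta> j Z * ip (X j) (X l))"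
    if "finite T" "T \<subseteq> {1..n}" for T
    using that
  proof (induction T)
    case empty
    show ?case using scale[of 0 0] subspace_0[OF subspace_L] by simp
  next
    case (insert j T)
    then have "X j \<in> L" "\<theta> j Z *\<^sub>R X j \<in> L"
      using frame_in[of j] subspace_scale[OF subspace_L] by auto
    then show ?case
      using insert by (simp add: add scale subspace_add[OF subspace_L])
  qed
  then have "ip (\<Sum>j\<in>{1..n}. \<theta> j Z *\<^sub>R X j) (X l) = (\<Sum>j\<in>{1..n}. \<theta> j Z * ip (X j) (X l))"
    by blast
  also have "\<dots> = (\<Sum>j\<in>{1..n}. if j = l then \<theta> l Z else 0)"
    using l by (intro sum.cong) (auto simp: orthonormal)
  also have "\<dots> = \<theta> l Z" using l by simp
  finally show ?thesis using frame_expansion[OF Z] by simp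
qed

lemma multilinear_expansion:
  assumes "\<omega> \<in> alternating_covectors L h" "length Ys = h" "set Ys \<subseteq> L"
  shows "\<omega> Ys = (\<Sum>J\<in>index_lists n h. (\<Prod>i<h. \<theta> (J ! i) (Ys ! i)) * \<omega> (map X J))"
  using assms
proof (induction h arbitrary: \<omega> Ys)
  case 0
  then show ?case by (simp add: index_lists_0)
next
  case (Suc h)
  then obtain Y Zs where Y: "Ys = Y # Zs" "length Zs = h" "set Zs \<subseteq> L" "Y \<in> L"
    by (cases Ys) auto
  have "\<omega> Ys = \<omega> ((\<Sum>j\<in>{1..n}. \<theta> j Y *\<^sub>R X j) # Zs)"
    using frame_expansion Y by metis
  also have "\<dots> = (\<Sum>j\<in>{1..n}. \<theta> j Y * contract (X j) \<omega> Zs)"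
    using Suc.prems(1) subspace_L frame_in
    by (subst alternating_head_sum) (auto simp: contract_def)
  also have "\<dots> = (\<Sum>j\<in>{1..n}. \<Sum>J\<in>index_lists n h.
      (\<Prod>i<Suc h. \<theta> ((j # J) ! i) (Ys ! i)) * \<omega> (map X (j # J)))"
  proof (rule sum.cong[OF refl])
    fix j assume "j \<in> {1..n}"
    then have "contract (X j) \<omega> \<in> alternating_covectors L h"
      using alternating_contract[OF Suc.prems(1)] frame_in by fastforce
    from Suc.IH[OF this Y(2,3)]
    show "\<theta> j Y * contract (X j) \<omega> Zs = (\<Sum>J\<in>index_lists n h.
      (\<Prod>i<Suc h. \<theta> ((j # J) ! i) (Ys ! i)) * \<omega> (map X (j # J)))"
      unfolding prod.lessThan_Suc_shift
      by (simp add: Y sum_distrib_left mult.assoc contract_def del: prod.lessThan_Suc)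
  qed
  finally show ?case by (simp add: sum_index_lists_Suc del: prod.lessThan_Suc)
qed

lemma wedge_dual:
  assumes "length Ys = length J"
  shows "wedge (map \<theta> J) Ys = (\<Sum>\<sigma> | \<sigma> permutes {..<length J}.
    of_int (sign \<sigma>) * (\<Prod>i<length J. \<theta> (J ! i) (permute_list \<sigma> Ys ! i)))"
  using assms unfolding wedge_def
  by (auto intro!: sum.cong prod.cong simp: permute_list_nth)

text \<open>In the summand of \<open>\<sigma>\<close> exactly one factor sees the argument in place \<open>k\<close>, the one with index
  \<open>\<sigma>\<^sup>-\<^sup>1 k\<close>. Splitting it off shows that the wedge product is linear in this argument.\<close>

lemma wedge_update:
  assumes "length Ys = length J" "k < length J"
  shows "wedge (map \<theta> J) (Ys[k := U]) = (\<Sum>\<sigma> | \<sigma> permutes {..<length J}. of_int (sign \<sigma>) *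
    (\<theta> (J ! inv_into UNIV \<sigma> k) U * (\<Prod>i\<in>{..<length J} - {inv_into UNIV \<sigma> k}. \<theta> (J ! i) (Ys ! \<sigma> i))))"
proof -
  have "(\<Prod>i<length J. \<theta> (J ! i) (Ys[k := U] ! \<sigma> i)) =
    \<theta> (J ! inv_into UNIV \<sigma> k) U * (\<Prod>i\<in>{..<length J} - {inv_into UNIV \<sigma> k}. \<theta> (J ! i) (Ys ! \<sigma> i))"
    if \<sigma>: "\<sigma> permutes {..<length J}" for \<sigma>
  proof -
    have m: "inv_into UNIV \<sigma> k < length J"
      using permutes_in_image[OF permutes_inv[OF \<sigma>], of k] assms by simp
    have "k \<noteq> \<sigma> i" if "i \<noteq> inv_into UNIV \<sigma> k" for i
      using permutes_inv_eq[OF \<sigma>, of k i] that by auto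
    then have "(\<Prod>i\<in>{..<length J} - {inv_into UNIV \<sigma> k}. \<theta> (J ! i) (Ys[k := U] ! \<sigma> i)) =
       (\<Prod>i\<in>{..<length J} - {inv_into UNIV \<sigma> k}. \<theta> (J ! i) (Ys ! \<sigma> i))"
      by (intro prod.cong) auto
    then show ?thesis
      using m assms by (subst prod.remove[of _ "inv_into UNIV \<sigma> k"])
        (simp_all add: permutes_inverses[OF \<sigma>])
  qed
  then have eq: "of_int (sign \<sigma>) * (\<Prod>i<length J. \<theta> (J ! i) (Ys[k := U] ! \<sigma> i)) = of_int (sign \<sigma>) *
    (\<theta> (J ! inv_into UNIV \<sigma> k) U *
      (\<Prod>i\<in>{..<length J} - {inv_into UNIV \<sigma> k}. \<theta> (J ! i) (Ys ! \<sigma> i)))"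
    if "\<sigma> \<in> {\<sigma>. \<sigma> permutes {..<length J}}" for \<sigma>
    using that by simp
  have "wedge (map \<theta> J) (Ys[k := U]) = (\<Sum>\<sigma> | \<sigma> permutes {..<length J}.
      of_int (sign \<sigma>) * (\<Prod>i<length J. \<theta> (J ! i) (Ys[k := U] ! \<sigma> i)))"
    using assms(1) by (simp add: wedge_def)
  also note sum.cong[OF refl eq]
  finally show ?thesis .
qed

lemma wedge_alternating:
  "wedge (map \<theta> J) \<in> alternating_covectors L (length J)"
proof (rule alternatingI)
  fix Ys assume *: "\<not> (length Ys = length J \<and> set Ys \<subseteq> L)"
  show "wedge (map \<theta> J) Ys = 0"
  proof (cases "length Ys = length J")
    case True
    then obtain m where m: "m < length J" "Ys ! m \<notin> L"
      using * by (metis in_set_conv_nth subsetI)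
    have "(\<Prod>i<length J. \<theta> (J ! i) (permute_list \<sigma> Ys ! i)) = 0" if \<sigma>: "\<sigma> permutes {..<length J}" for \<sigma>
    proof -
      obtain i where "i < length J" "\<sigma> i = m"
        using permutes_surj[OF \<sigma>] permutes_in_image[OF \<sigma>] m by (metis lessThan_iff surjD)
      then show ?thesis
        using m \<sigma> True by (auto intro!: exI[of _ i] bexI[of _ i] simp: permute_list_nth dual_outside)
    qed
    then show ?thesis unfolding wedge_dual[OF True] by (intro sum.neutral) auto
  qed (simp add: wedge_def)
next
  fix Ys k Y Z assume *: "length Ys = length J" "set Ys \<subseteq> L" "k < length J" "Y \<in> L" "Z \<in> L"
  show "wedge (map \<theta> J) (Ys[k := Y + Z]) = wedge (map \<theta> J) (Ys[k := Y]) + wedge (map \<theta> J) (Ys[k := Z])"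
    unfolding wedge_update[OF *(1,3)] using *
    by (simp add: dual_add algebra_simps sum.distrib)
next
  fix Ys k Y c assume *: "length Ys = length J" "set Ys \<subseteq> L" "k < length J" "Y \<in> L"
  show "wedge (map \<theta> J) (Ys[k := c *\<^sub>R Y]) = c * wedge (map \<theta> J) (Ys[k := Y])"
    unfolding wedge_update[OF *(1,3)] using *
    by (simp add: dual_scale sum_distrib_left mult_ac)
next
  fix Ys assume *: "length Ys = length J" "set Ys \<subseteq> L" "\<not> distinct Ys"
  then obtain a b where ab: "a < length J" "b < length J" "a \<noteq> b" "Ys ! a = Ys ! b"
    by (auto simp: distinct_conv_nth)
  let ?\<tau> = "Transposition.transpose a b" and ?S = "{\<sigma>. \<sigma> permutes {..<length J}}"
  define f where "f \<sigma> = of_int (sign \<sigma>) * (\<Prod>i<length J. \<theta> (J ! i) (Ys ! \<sigma> i))" for \<sigma>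
  have \<tau>: "?\<tau> permutes {..<length J}" using ab by (intro permutes_swap_id) auto
  have "(\<Sum>\<sigma>\<in>?S. f \<sigma>) = (\<Sum>\<sigma>\<in>?S. f (?\<tau> \<circ> \<sigma>))"
    using setum_permutations_compose_left[OF \<tau>] .
  also have "\<dots> = (\<Sum>\<sigma>\<in>?S. - f \<sigma>)"
  proof (rule sum.cong[OF refl])
    fix \<sigma> assume "\<sigma> \<in> ?S"
    then have "sign (?\<tau> \<circ> \<sigma>) = - sign \<sigma>"
      using ab by (subst sign_compose)
        (auto simp: sign_swap_id permutation_swap_id intro: permutes_imp_permutation[of "{..<length J}"])
    moreover have "Ys ! ?\<tau> k = Ys ! k" for k
      using ab by (auto simp: Transposition.transpose_def)
    ultimately show "f (?\<tau> \<circ> \<sigma>) = - f \<sigma>" by (simp add: f_def)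
  qed
  finally have "(\<Sum>\<sigma>\<in>?S. f \<sigma>) = 0" by (simp add: sum_negf)
  then show "wedge (map \<theta> J) Ys = 0" using * by (simp add: wedge_def f_def)
qed

text \<open>Summing over all index lists instead of the strictly increasing ones avoids a choice of
  representatives: every increasing list is counted once for each of its \<open>h!\<close> rearrangements, with
  the same contribution. In the proof the sum over lists is carried out first, and then each
  permutation contributes the square of its sign.\<close>

lemma wedge_expansion:
  assumes "\<omega> \<in> alternating_covectors L h"
  shows "\<omega> Ys = (\<Sum>J\<in>index_lists n h. wedge (map \<theta> J) Ys * \<omega> (map X J)) / fact h"
proof (cases "length Ys = h \<and> set Ys \<subseteq> L")
  case True
  then have that: "length Ys = h" "set Ys \<subseteq> L" by auto
  have "(\<Sum>J\<in>index_lists n h. wedge (map \<theta> J) Ys * \<omega> (map X J)) =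
    (\<Sum>J\<in>index_lists n h. \<Sum>\<sigma> | \<sigma> permutes {..<h}.
       of_int (sign \<sigma>) * ((\<Prod>i<h. \<theta> (J ! i) (permute_list \<sigma> Ys ! i)) * \<omega> (map X J)))"
    using that by (intro sum.cong) (auto simp: index_lists_def wedge_dual sum_distrib_right mult.assoc)
  also have "\<dots> = (\<Sum>\<sigma> | \<sigma> permutes {..<h}. of_int (sign \<sigma>) *
      (\<Sum>J\<in>index_lists n h. (\<Prod>i<h. \<theta> (J ! i) (permute_list \<sigma> Ys ! i)) * \<omega> (map X J)))"
    by (subst sum.swap) (simp add: sum_distrib_left)
  also have "\<dots> = (\<Sum>\<sigma> | \<sigma> permutes {..<h}. of_int (sign \<sigma>) * \<omega> (permute_list \<sigma> Ys))"
    using that assms by (intro sum.cong) (auto simp: multilinear_expansion[symmetric])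
  also have "\<dots> = (\<Sum>\<sigma> | \<sigma> permutes {..<h}. \<omega> Ys)"
    using that assms subspace_L
    by (intro sum.cong) (simp_all add: alternating_permute mult.assoc[symmetric] of_int_mult[symmetric] del: of_int_mult)
  also have "\<dots> = fact h * \<omega> Ys"
    by (simp add: card_permutations)
  finally show ?thesis by simp
next
  case False
  then have "wedge (map \<theta> J) Ys = 0" if "J \<in> index_lists n h" for J
    using that alternatingD(1)[OF wedge_alternating, of Ys J] by (auto simp: index_lists_def)
  then show ?thesis
    using alternatingD(1)[OF assms False] by simp
qed

text \<open>This is why a wedge product of dual covectors has a well-defined weight: it detects only the
  rearrangements of its own index list, and these have the same weight.\<close>

lemma wedge_frame_nonzero:
  assumes "wedge (map \<theta> J) (map X K) \<noteq> 0" "set J \<subseteq> {1..n}" "set K \<subseteq> {1..n}"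
  shows "mset J = mset K"
proof -
  have len: "length K = length J" using assms(1) by (auto simp: wedge_def split: if_splits)
  obtain \<sigma> where \<sigma>: "\<sigma> permutes {..<length J}"
    and nz: "(\<Prod>i<length J. \<theta> (J ! i) (permute_list \<sigma> (map X K) ! i)) \<noteq> 0"
    using assms(1) len by (auto simp: wedge_dual elim!: sum.not_neutral_contains_not_neutral)
  have "J ! i = K ! \<sigma> i" if "i < length J" for i
  proof -
    have 1: "\<sigma> i < length J" using permutes_in_image[OF \<sigma>] that by simp
    have "\<theta> (J ! i) (permute_list \<sigma> (map X K) ! i) \<noteq> 0"
      using nz that by auto
    then have "\<theta> (J ! i) (X (K ! \<sigma> i)) \<noteq> 0"
      using that \<sigma> len 1 by (simp add: permute_list_nth)
    moreover have "J ! i \<in> {1..n}" "K ! \<sigma> i \<in> {1..n}"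
      using assms(2,3) that 1 len by (auto simp: subset_iff)
    ultimately show ?thesis by (auto simp: dual_frame split: if_splits)
  qed
  then have eq: "J = permute_list \<sigma> K"
    using len \<sigma> by (intro nth_equalityI) (simp_all add: permute_list_nth)
  have "mset (permute_list \<sigma> K) = mset K"
    using mset_permute_list[of \<sigma> K] \<sigma> len by simp
  then show ?thesis
    unfolding eq[symmetric] .
qed

end

section \<open>Smooth functions on a manifold\<close>

text \<open>Openness matters here: the derivative that occurs in the definition of \<open>Ck_on\<close> is taken in the
  whole space, so functions that agree on \<open>S\<close> have the same derivatives only at interior points.\<close>

lemma Ck_on_cong:
  assumes "open S" "\<And>x. x \<in> S \<Longrightarrow> f x = g x" "Ck_on k S f"
  shows "Ck_on k S g"
  using assms(2,3)
proof (induction k arbitrary: f g)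
  case 0
  then show ?case by (simp cong: continuous_on_cong)
next
  case (Suc k)
  have df: "f differentiable (at x)" if "x \<in> S" for x
    using Suc.prems(2) that by simp
  have dg: "g differentiable (at x)" if "x \<in> S" for x
    using has_derivative_transform_within_open[OF _ assms(1) that, of f _ UNIV g] df[OF that] Suc.prems(1)
    unfolding differentiable_def by blast
  have eq: "frechet_derivative f (at x) v = frechet_derivative g (at x) v" if "x \<in> S" for x v
    using frechet_derivative_transform_within_open[OF df[OF that] assms(1) that, of g] Suc.prems(1) by simp
  have "Ck_on k S (\<lambda>x. frechet_derivative g (at x) v)" for v
    by (rule Suc.IH[of "\<lambda>x. frechet_derivative f (at x) v"]) (use Suc.prems(2) eq in simp_all)
  then show ?case
    using dg by simp
qed

lemma Ck_on_SucD:
  "Ck_on (Suc k) S f \<Longrightarrow> Ck_on k S f"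
proof (induction k arbitrary: f)
  case 0
  then show ?case
    by (auto intro!: continuous_at_imp_continuous_on differentiable_imp_continuous_within)
next
  case (Suc k)
  have "Ck_on k S (\<lambda>x. frechet_derivative f (at x) v)" for v
    using Suc.prems by (intro Suc.IH) simp
  then show ?case using Suc.prems by simp
qed

lemma Ck_on_const: "Ck_on k S (\<lambda>x. c)"
  by (induction k arbitrary: c) simp_all

lemma Ck_on_add:
  assumes "open S" "Ck_on k S f" "Ck_on k S g"
  shows "Ck_on k S (\<lambda>x. f x + g x)"
  using assms(2,3)
proof (induction k arbitrary: f g)
  case 0
  then show ?case by (simp add: continuous_on_add)
next
  case (Suc k)
  have d: "((\<lambda>x. f x + g x) has_derivative (\<lambda>v. frechet_derivative f (at x) v + frechet_derivative g (at x) v)) (at x)"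
    if "x \<in> S" for x
    using that Suc.prems by (intro has_derivative_add) (simp_all add: frechet_derivative_works[symmetric])
  have "Ck_on k S (\<lambda>x. frechet_derivative f (at x) v + frechet_derivative g (at x) v)" for v
    using Suc.prems by (intro Suc.IH) simp_all
  moreover have "frechet_derivative f (at x) v + frechet_derivative g (at x) v = frechet_derivative (\<lambda>x. f x + g x) (at x) v" if "x \<in> S" for x v
    using fun_cong[OF frechet_derivative_at[OF d[OF that]], of v] by simp
  ultimately have "Ck_on k S (\<lambda>x. frechet_derivative (\<lambda>x. f x + g x) (at x) v)" for v
    using Ck_on_cong[OF assms(1), of "\<lambda>x. frechet_derivative f (at x) v + frechet_derivative g (at x) v" "\<lambda>x. frechet_derivative (\<lambda>x. f x + g x) (at x) v" k for v] by blast
  then show ?case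
    using differentiableI[OF d] by simp
qed

lemma Ck_on_mult:
  fixes f g :: "'a::real_normed_vector \<Rightarrow> real"
  assumes "open S" "Ck_on k S f" "Ck_on k S g"
  shows "Ck_on k S (\<lambda>x. f x * g x)"
  using assms(2,3)
proof (induction k arbitrary: f g)
  case 0
  then show ?case by (simp add: continuous_on_mult)
next
  case (Suc k)
  have d: "((\<lambda>x. f x * g x) has_derivative (\<lambda>v. f x * frechet_derivative g (at x) v + frechet_derivative f (at x) v * g x)) (at x)"
    if "x \<in> S" for x
    using that Suc.prems by (intro has_derivative_mult) (simp_all add: frechet_derivative_works[symmetric])
  have "Ck_on k S (\<lambda>x. f x * frechet_derivative g (at x) v + frechet_derivative f (at x) v * g x)" for v
    using Suc.prems Ck_on_SucD[OF Suc.prems(1)] Ck_on_SucD[OF Suc.prems(2)]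
    by (intro Ck_on_add[OF assms(1)] Suc.IH) simp_all
  moreover have "f x * frechet_derivative g (at x) v + frechet_derivative f (at x) v * g x = frechet_derivative (\<lambda>x. f x * g x) (at x) v" if "x \<in> S" for x v
    using fun_cong[OF frechet_derivative_at[OF d[OF that]], of v] by simp
  ultimately have "Ck_on k S (\<lambda>x. frechet_derivative (\<lambda>x. f x * g x) (at x) v)" for v
    using Ck_on_cong[OF assms(1), of "\<lambda>x. f x * frechet_derivative g (at x) v + frechet_derivative f (at x) v * g x" "\<lambda>x. frechet_derivative (\<lambda>x. f x * g x) (at x) v" k for v] by blast
  then show ?case
    using differentiableI[OF d] by simp
qed

text \<open>On the target side the chart of the real line is the identity, so only the charts of the
  manifold remain.\<close>

lemma smooth_functions_iff:
  "f \<in> smooth_functions A \<longleftrightarrow>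
    continuous_on UNIV f \<and>
    (\<forall>U \<phi> k. (U, \<phi>) \<in> A \<longrightarrow> Ck_on k (\<phi> ` U) (\<lambda>y. f (inv_into U \<phi> y)))"
  by (auto simp: smooth_functions_def smooth_map_def smooth_on_def comp_def)

lemma smooth_functions_const: "(\<lambda>x. c) \<in> smooth_functions A"
  by (auto simp: smooth_functions_iff Ck_on_const)

lemma smooth_functions_add:
  assumes A: "smooth_atlas A" and f: "f \<in> smooth_functions A" and g: "g \<in> smooth_functions A"
  shows "f + g \<in> smooth_functions A"
  unfolding smooth_functions_iff plus_fun_def
proof (intro conjI allI impI)
  show "continuous_on UNIV (\<lambda>x. f x + g x)"
    using f g by (intro continuous_on_add) (simp_all add: smooth_functions_iff)
  fix U \<phi> k assume c: "(U, \<phi>) \<in> A"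
  then have "open (\<phi> ` U)" using A by (auto simp: smooth_atlas_def)
  then show "Ck_on k (\<phi> ` U) (\<lambda>y. f (inv_into U \<phi> y) + g (inv_into U \<phi> y))"
    using f g c by (intro Ck_on_add) (simp_all add: smooth_functions_iff)
qed

lemma smooth_functions_mult:
  assumes A: "smooth_atlas A" and f: "f \<in> smooth_functions A" and g: "g \<in> smooth_functions A"
  shows "f * g \<in> smooth_functions A"
  unfolding smooth_functions_iff times_fun_def
proof (intro conjI allI impI)
  show "continuous_on UNIV (\<lambda>x. f x * g x)"
    using f g by (intro continuous_on_mult) (simp_all add: smooth_functions_iff)
  fix U \<phi> k assume c: "(U, \<phi>) \<in> A"
  then have "open (\<phi> ` U)" using A by (auto simp: smooth_atlas_def)
  then show "Ck_on k (\<phi> ` U) (\<lambda>y. f (inv_into U \<phi> y) * g (inv_into U \<phi> y))"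
    using f g c by (intro Ck_on_mult) (simp_all add: smooth_functions_iff)
qed

lemma subspace_smooth_functions:
  assumes "smooth_atlas A"
  shows "subspace (smooth_functions A)"
  unfolding subspace_def
proof (intro conjI ballI allI)
  show "0 \<in> smooth_functions A"
    using smooth_functions_const[of 0] by (simp add: zero_fun_def)
  fix c f assume "f \<in> smooth_functions A"
  then have "(\<lambda>x. c) * f \<in> smooth_functions A"
    using assms smooth_functions_const by (intro smooth_functions_mult)
  then show "c *\<^sub>R f \<in> smooth_functions A"
    by (simp add: scaleR_fun_def times_fun_def)
qed (rule smooth_functions_add[OF assms])

section \<open>Left-invariant vector fields\<close>

lemma lie_bracket_apply: "lie_bracket X Y f = X (Y f) - Y (X f)"
  by (simp add: lie_bracket_def)

lemma lie_bracket_self: "lie_bracket X X = 0"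
  by (simp add: lie_bracket_def fun_eq_iff)

locale manifold_group =
  fixes G :: "('g::topological_space) monoid" and A :: "('g, 'e::euclidean_space) chart set"
  assumes atlas: "smooth_atlas A"
begin

abbreviation "F \<equiv> smooth_functions A"
abbreviation "\<gg> \<equiv> lie_algebra G A"

lemma F_closed:
  "0 \<in> F" "f \<in> F \<Longrightarrow> g \<in> F \<Longrightarrow> f + g \<in> F" "f \<in> F \<Longrightarrow> g \<in> F \<Longrightarrow> f - g \<in> F" "f \<in> F \<Longrightarrow> - f \<in> F"
  "f \<in> F \<Longrightarrow> c *\<^sub>R f \<in> F" "f \<in> F \<Longrightarrow> g \<in> F \<Longrightarrow> f * g \<in> F"
  using subspace_smooth_functions[OF atlas]
  by (auto simp: subspace_0 subspace_add subspace_diff subspace_neg subspace_scale smooth_functions_mult[OF atlas])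

lemma lie_algebraD:
  assumes "Y \<in> \<gg>"
  shows "f \<notin> F \<Longrightarrow> Y f = 0" "f \<in> F \<Longrightarrow> Y f \<in> F"
    "f \<in> F \<Longrightarrow> h \<in> F \<Longrightarrow> Y (f + h) = Y f + Y h"
    "f \<in> F \<Longrightarrow> Y (c *\<^sub>R f) = c *\<^sub>R Y f"
    "f \<in> F \<Longrightarrow> h \<in> F \<Longrightarrow> Y (f * h) = Y f * h + f * Y h"
    "f \<in> F \<Longrightarrow> Y (\<lambda>x. f (a \<otimes>\<^bsub>G\<^esub> x)) = (\<lambda>x. Y f (a \<otimes>\<^bsub>G\<^esub> x))"
  using assms unfolding lie_algebra_def by blast+

lemma lie_algebra_linear:
  assumes "Y \<in> \<gg>"
  shows "Y 0 = 0" "f \<in> F \<Longrightarrow> Y (- f) = - Y f" "f \<in> F \<Longrightarrow> h \<in> F \<Longrightarrow> Y (f - h) = Y f - Y h"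
    "Y f \<in> F"
proof -
  show 0: "Y 0 = 0" using lie_algebraD(4)[OF assms F_closed(1), of 0] by simp
  show m: "Y (- f) = - Y f" if "f \<in> F" for f using lie_algebraD(4)[OF assms that, of "-1"] by simp
  show "Y (f - h) = Y f - Y h" if "f \<in> F" "h \<in> F"
    using lie_algebraD(3)[OF assms that(1) F_closed(4)[OF that(2)]] m[OF that(2)] by simp
  show "Y f \<in> F"
    using lie_algebraD(1,2)[OF assms] F_closed(1) by (cases "f \<in> F") auto
qed

lemma lie_algebraI:
  assumes "\<And>f. f \<notin> F \<Longrightarrow> Y f = 0" "\<And>f. f \<in> F \<Longrightarrow> Y f \<in> F"
    "\<And>f h. f \<in> F \<Longrightarrow> h \<in> F \<Longrightarrow> Y (f + h) = Y f + Y h"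
    "\<And>c f. f \<in> F \<Longrightarrow> Y (c *\<^sub>R f) = c *\<^sub>R Y f"
    "\<And>f h. f \<in> F \<Longrightarrow> h \<in> F \<Longrightarrow> Y (f * h) = Y f * h + f * Y h"
    "\<And>a f. f \<in> F \<Longrightarrow> Y (\<lambda>x. f (a \<otimes>\<^bsub>G\<^esub> x)) = (\<lambda>x. Y f (a \<otimes>\<^bsub>G\<^esub> x))"
  shows "Y \<in> \<gg>"
  using assms unfolding lie_algebra_def by blast

lemma lie_bracket_closed:
  assumes "Y \<in> \<gg>" "Z \<in> \<gg>"
  shows "lie_bracket Y Z \<in> \<gg>"
proof -
  note D = lie_algebraD[OF assms(1)] lie_algebraD[OF assms(2)]
    lie_algebra_linear[OF assms(1)] lie_algebra_linear[OF assms(2)]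
  show ?thesis
    by (rule lie_algebraI)
      (simp_all add: lie_bracket_apply D F_closed algebra_simps fun_eq_iff)
qed

lemma lie_bracket_linear:
  assumes "Y \<in> \<gg>" "Y' \<in> \<gg>" "Z \<in> \<gg>"
  shows "lie_bracket (Y + Y') Z = lie_bracket Y Z + lie_bracket Y' Z"
    "lie_bracket (c *\<^sub>R Y) Z = c *\<^sub>R lie_bracket Y Z"
    "lie_bracket Z (Y + Y') = lie_bracket Z Y + lie_bracket Z Y'"
    "lie_bracket Z (c *\<^sub>R Y) = c *\<^sub>R lie_bracket Z Y"
  using lie_algebraD(3,4)[OF assms(3)] lie_algebra_linear(4)[OF assms(1)] lie_algebra_linear(4)[OF assms(2)]
  by (simp_all add: lie_bracket_def fun_eq_iff scaleR_fun_def algebra_simps)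

text \<open>The Jacobi identity in its derivation form: taking the bracket with \<open>X\<close> is a derivation. For
  operators it is a formal consequence of the associativity of composition.\<close>

lemma jacobi:
  assumes "X \<in> \<gg>" "Y \<in> \<gg>" "Z \<in> \<gg>"
  shows "lie_bracket (lie_bracket X Y) Z = lie_bracket X (lie_bracket Y Z) - lie_bracket Y (lie_bracket X Z)"
  by (rule ext) (simp add: lie_bracket_apply assms[THEN lie_algebra_linear(3)] assms[THEN lie_algebra_linear(4)])

end

section \<open>Cartan calculus on forms\<close>

text \<open>The Lie derivative \<open>\<L>\<^sub>Y \<alpha> (Z\<^sub>1, \<dots>) = Y (\<alpha> (Z\<^sub>1, \<dots>)) - \<Sum>\<^sub>j \<alpha> (\<dots>, [Y, Z\<^sub>j], \<dots>)\<close>. The recursion is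
  the commutation rule with contractions, read as a definition, so that identities can be proved by
  peeling off arguments. The guard makes the result vanish on arguments outside the Lie algebra.\<close>

fun lie_derivative :: "'g vfield set \<Rightarrow> 'g vfield \<Rightarrow> 'g dform \<Rightarrow> 'g dform" where
  "lie_derivative L Y \<alpha> [] = Y (\<alpha> [])"
| "lie_derivative L Y \<alpha> (Z # Zs) =
     (if Z \<in> L then lie_derivative L Y (contract Z \<alpha>) Zs - \<alpha> (lie_bracket Y Z # Zs) else 0)"

lemma scaleR_apply: "(c *\<^sub>R f) x = c *\<^sub>R f x"
  by (simp add: scaleR_fun_def)

lemma contract_linear:
  "contract Y (\<alpha> + \<beta>) = contract Y \<alpha> + contract Y \<beta>"
  "contract Y (\<alpha> - \<beta>) = contract Y \<alpha> - contract Y \<beta>"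
  "contract Y (c *\<^sub>R \<gamma>) = c *\<^sub>R contract Y \<gamma>"
  "contract Y 0 = 0"
  by (simp_all add: contract_def fun_eq_iff scaleR_apply)

context manifold_group
begin

text \<open>Elements of the Lie algebra are additive on smooth functions, but they send all other functions to
  zero; so \<open>\<L>\<^sub>Y\<close> and \<open>d\<close> are linear on forms with smooth values.\<close>

definition smooth_valued :: "'g dform set" where
  "smooth_valued = {\<alpha>. \<forall>Ys. \<alpha> Ys \<in> F}"

text \<open>The smooth forms described without the tensor product; the lemma \<open>forms_eq_alternating_forms\<close>
  below identifies them with the span of the products \<open>\<omega> \<otimes> f\<close>.\<close>

definition alternating_forms :: "nat \<Rightarrow> 'g dform set" where
  "alternating_forms h =
    {\<alpha> \<in> smooth_valued. \<forall>x. (\<lambda>Ys. \<alpha> Ys x) \<in> alternating_covectors \<gg> h}"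

abbreviation "d \<equiv> ext_deriv G A"
abbreviation "\<L> \<equiv> lie_derivative \<gg>"

lemma smooth_valuedD: "\<alpha> \<in> smooth_valued \<Longrightarrow> \<alpha> Ys \<in> F"
  by (simp add: smooth_valued_def)

lemma smooth_valued_closed:
  "0 \<in> smooth_valued" "\<alpha> \<in> smooth_valued \<Longrightarrow> \<beta> \<in> smooth_valued \<Longrightarrow> \<alpha> + \<beta> \<in> smooth_valued"
  "\<alpha> \<in> smooth_valued \<Longrightarrow> \<beta> \<in> smooth_valued \<Longrightarrow> \<alpha> - \<beta> \<in> smooth_valued"
  "\<alpha> \<in> smooth_valued \<Longrightarrow> c *\<^sub>R \<alpha> \<in> smooth_valued"
  "\<alpha> \<in> smooth_valued \<Longrightarrow> contract Y \<alpha> \<in> smooth_valued"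
  by (auto simp: smooth_valued_def contract_def F_closed scaleR_apply)

lemma subspace_smooth_valued: "subspace smooth_valued"
  by (simp add: subspace_def smooth_valued_closed)

lemma alternating_formsI:
  "\<alpha> \<in> smooth_valued \<Longrightarrow> (\<And>x. (\<lambda>Ys. \<alpha> Ys x) \<in> alternating_covectors \<gg> h) \<Longrightarrow> \<alpha> \<in> alternating_forms h"
  by (simp add: alternating_forms_def)

lemma form_smooth: "\<alpha> \<in> alternating_forms h \<Longrightarrow> \<alpha> \<in> smooth_valued"
  by (simp add: alternating_forms_def)

lemma form_at: "\<alpha> \<in> alternating_forms h \<Longrightarrow> (\<lambda>Ys. \<alpha> Ys x) \<in> alternating_covectors \<gg> h"
  by (simp add: alternating_forms_def)

lemma subspace_alternating_forms: "subspace (alternating_forms h)"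
proof -
  note S = subspace_alternating_covectors[of \<gg> h]
  have "(\<lambda>Ys. (0::'g dform) Ys x) \<in> alternating_covectors \<gg> h" for x
    using subspace_0[OF S] by (simp add: zero_fun_def)
  moreover have "(\<lambda>Ys. (\<alpha> + \<beta>) Ys x) \<in> alternating_covectors \<gg> h"
    if "\<alpha> \<in> alternating_forms h" "\<beta> \<in> alternating_forms h" for \<alpha> \<beta> x
    using subspace_add[OF S form_at[OF that(1)] form_at[OF that(2)]] by (simp add: plus_fun_def)
  moreover have "(\<lambda>Ys. (c *\<^sub>R \<alpha>) Ys x) \<in> alternating_covectors \<gg> h"
    if "\<alpha> \<in> alternating_forms h" for \<alpha> c x
    using subspace_scale[OF S form_at[OF that], of c] by (simp add: scaleR_fun_def)
  ultimately show ?thesis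
    unfolding subspace_def
    by (auto intro!: alternating_formsI smooth_valued_closed dest: form_smooth)
qed

lemmas form_diff = subspace_diff[OF subspace_alternating_forms]

lemma form_contract:
  assumes "\<alpha> \<in> alternating_forms h" "Y \<in> \<gg>"
  shows "contract Y \<alpha> \<in> alternating_forms (h - 1)"
proof (rule alternating_formsI)
  show "contract Y \<alpha> \<in> smooth_valued"
    using assms by (intro smooth_valued_closed form_smooth)
  show "(\<lambda>Ys. contract Y \<alpha> Ys x) \<in> alternating_covectors \<gg> (h - 1)" for x
    using alternating_contract[OF form_at[OF assms(1)] assms(2), of x]
    by (simp add: contract_def[abs_def])
qed

lemma form_outside:
  "\<alpha> \<in> alternating_forms h \<Longrightarrow> \<not> (length Ys = h \<and> set Ys \<subseteq> \<gg>) \<Longrightarrow> \<alpha> Ys = 0"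
  using alternatingD(1)[OF form_at] by (auto simp: fun_eq_iff)

lemma subspace_lie_algebra: "subspace \<gg>"
  unfolding subspace_def
proof (intro conjI ballI allI)
  show "0 \<in> \<gg>" by (rule lie_algebraI) (simp_all add: F_closed fun_eq_iff)
  fix Y Z assume "Y \<in> \<gg>" "Z \<in> \<gg>"
  note D = lie_algebraD[OF this(1)] lie_algebraD[OF this(2)]
  show "Y + Z \<in> \<gg>"
    by (rule lie_algebraI) (simp_all add: D F_closed algebra_simps fun_eq_iff)
next
  fix c Y assume "Y \<in> \<gg>"
  note D = lie_algebraD[OF this]
  show "c *\<^sub>R Y \<in> \<gg>"
    by (rule lie_algebraI)
      (simp_all add: D F_closed scaleR_add_right scaleR_left_commute fun_eq_iff scaleR_apply algebra_simps)
qed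

lemma form_head_linear:
  assumes "\<alpha> \<in> alternating_forms h" "Y \<in> \<gg>"
  shows "Z \<in> \<gg> \<Longrightarrow> contract (Y + Z) \<alpha> = contract Y \<alpha> + contract Z \<alpha>"
    and "contract (c *\<^sub>R Y) \<alpha> = c *\<^sub>R contract Y \<alpha>"
  using alternating_head_add[OF form_at[OF assms(1)] subspace_lie_algebra assms(2)]
    alternating_head_scale[OF form_at[OF assms(1)] subspace_lie_algebra assms(2)]
  by (simp_all add: contract_def fun_eq_iff scaleR_apply)

lemma form_twice:
  "\<alpha> \<in> alternating_forms h \<Longrightarrow> Y \<in> \<gg> \<Longrightarrow> contract Y (contract Y \<alpha>) = 0"
  using alternating_twice[OF form_at] by (simp add: contract_def fun_eq_iff)

lemma form_swap:
  "\<alpha> \<in> alternating_forms h \<Longrightarrow> Y \<in> \<gg> \<Longrightarrow> Z \<in> \<gg> \<Longrightarrow> \<alpha> (Y # Z # Ws) = - \<alpha> (Z # Y # Ws)"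
  using alternating_swap[OF form_at subspace_lie_algebra] by (simp add: fun_eq_iff)

lemma form_swap_contract:
  "\<alpha> \<in> alternating_forms h \<Longrightarrow> Y \<in> \<gg> \<Longrightarrow> Z \<in> \<gg> \<Longrightarrow>
    contract Y (contract Z \<alpha>) = - contract Z (contract Y \<alpha>)"
  by (rule ext) (use form_swap[of \<alpha> h Z Y] in \<open>simp add: contract_def\<close>)

lemma form_SucI:
  assumes "\<beta> \<in> smooth_valued" "\<beta> [] = 0" "\<And>Y. Y \<notin> \<gg> \<Longrightarrow> contract Y \<beta> = 0"
    and "\<And>Y. Y \<in> \<gg> \<Longrightarrow> contract Y \<beta> \<in> alternating_forms h"
    and "\<And>Y Z. Y \<in> \<gg> \<Longrightarrow> Z \<in> \<gg> \<Longrightarrow> contract (Y + Z) \<beta> = contract Y \<beta> + contract Z \<beta>"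
    and "\<And>Y c. Y \<in> \<gg> \<Longrightarrow> contract (c *\<^sub>R Y) \<beta> = c *\<^sub>R contract Y \<beta>"
    and "\<And>Y. Y \<in> \<gg> \<Longrightarrow> contract Y (contract Y \<beta>) = 0"
  shows "\<beta> \<in> alternating_forms (Suc h)"
proof (rule alternating_formsI[OF assms(1)])
  fix x
  show "(\<lambda>Ys. \<beta> Ys x) \<in> alternating_covectors \<gg> (Suc h)"
  proof (rule alternating_SucI[OF subspace_lie_algebra])
    show "contract Y (\<lambda>Ys. \<beta> Ys x) \<in> alternating_covectors \<gg> h" if "Y \<in> \<gg>" for Y
      using form_at[OF assms(4)[OF that]] by (simp add: contract_def[abs_def])
  qed (use assms(2,3,5,6,7) in \<open>simp_all add: contract_def fun_eq_iff scaleR_apply\<close>)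
qed

lemma form_0I:
  assumes "\<beta> \<in> smooth_valued" "\<And>Y Ys. \<beta> (Y # Ys) = 0"
  shows "\<beta> \<in> alternating_forms 0"
proof (rule alternating_formsI[OF assms(1)], rule alternatingI)
  fix x :: 'g and Ys :: "'g vfield list" assume "\<not> (length Ys = 0 \<and> set Ys \<subseteq> \<gg>)"
  then show "\<beta> Ys x = 0" by (cases Ys) (auto simp: assms(2))
qed simp_all

lemma form_0_contract:
  "\<alpha> \<in> alternating_forms 0 \<Longrightarrow> contract Y \<alpha> = 0"
  by (auto simp: contract_def fun_eq_iff form_outside)

lemma lie_derivative_smooth:
  "\<alpha> \<in> smooth_valued \<Longrightarrow> Y \<in> \<gg> \<Longrightarrow> \<L> Y \<alpha> \<in> smooth_valued"
proof -
  assume Y: "Y \<in> \<gg>" 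
  have "\<L> Y \<alpha> Ys \<in> F" if "\<alpha> \<in> smooth_valued" for Ys \<alpha>
    using that
    by (induction Ys arbitrary: \<alpha>)
      (auto simp: lie_algebra_linear[OF Y] smooth_valuedD F_closed smooth_valued_closed)
  then show "\<alpha> \<in> smooth_valued \<Longrightarrow> \<L> Y \<alpha> \<in> smooth_valued"
    by (simp add: smooth_valued_def)
qed

lemma lie_derivative_add:
  assumes "\<alpha> \<in> smooth_valued" "\<beta> \<in> smooth_valued" "Y \<in> \<gg>"
  shows "\<L> Y (\<alpha> + \<beta>) = \<L> Y \<alpha> + \<L> Y \<beta>"
proof
  fix Ys show "\<L> Y (\<alpha> + \<beta>) Ys = (\<L> Y \<alpha> + \<L> Y \<beta>) Ys"
    using assms(1,2)
    by (induction Ys arbitrary: \<alpha> \<beta>)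
      (auto simp: lie_algebraD(3)[OF assms(3)] smooth_valuedD contract_linear smooth_valued_closed)
qed

lemma lie_derivative_scale:
  assumes "\<alpha> \<in> smooth_valued" "Y \<in> \<gg>"
  shows "\<L> Y (c *\<^sub>R \<alpha>) = c *\<^sub>R \<L> Y \<alpha>"
proof
  fix Ys show "\<L> Y (c *\<^sub>R \<alpha>) Ys = (c *\<^sub>R \<L> Y \<alpha>) Ys"
    using assms(1)
    by (induction Ys arbitrary: \<alpha>)
      (auto simp: lie_algebraD(4)[OF assms(2)] smooth_valuedD contract_linear smooth_valued_closed
        scaleR_apply scaleR_diff_right)
qed

lemma lie_derivative_diff:
  assumes "\<alpha> \<in> smooth_valued" "\<beta> \<in> smooth_valued" "Y \<in> \<gg>"
  shows "\<L> Y (\<alpha> - \<beta>) = \<L> Y \<alpha> - \<L> Y \<beta>"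
  using lie_derivative_add[of \<alpha> "(-1) *\<^sub>R \<beta>" Y] lie_derivative_scale[of \<beta> Y "-1"] assms
  by (simp add: smooth_valued_closed(4)[of _ "-1", simplified])

lemma contract_lie_derivative:
  "Z \<in> \<gg> \<Longrightarrow> contract Z (\<L> Y \<alpha>) = \<L> Y (contract Z \<alpha>) - contract (lie_bracket Y Z) \<alpha>"
  by (simp add: contract_def fun_eq_iff)

lemma lie_derivative_zero: "Y \<in> \<gg> \<Longrightarrow> \<L> Y 0 = 0"
  using lie_derivative_scale[OF smooth_valued_closed(1), of Y 0] by simp

text \<open>By induction on the degree. The only point that is not immediate from the commutation rule is
  \<open>\<iota>\<^sub>Z \<iota>\<^sub>Z \<L>\<^sub>Y \<alpha> = 0\<close>: moving both contractions inwards leaves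
  \<open>- \<iota>\<^bsub>[Y,Z]\<^esub> \<iota>\<^sub>Z \<alpha> - \<iota>\<^sub>Z \<iota>\<^bsub>[Y,Z]\<^esub> \<alpha>\<close>, which vanishes because contractions anticommute.\<close>

lemma lie_derivative_form:
  assumes "\<alpha> \<in> alternating_forms h" "Y \<in> \<gg>"
  shows "\<L> Y \<alpha> \<in> alternating_forms h"
  using assms(1)
proof (induction h arbitrary: \<alpha>)
  case 0
  then show ?case
    using assms(2) form_0_contract[OF 0] form_outside[OF 0] lie_derivative_zero[OF assms(2)]
    by (intro form_0I lie_derivative_smooth form_smooth) auto
next
  case (Suc h)
  note bracket = lie_bracket_closed[OF assms(2)]
  note smooth = form_smooth[OF Suc.prems]
  note c = contract_lie_derivative
  show ?case
  proof (rule form_SucI)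
    show "\<L> Y \<alpha> \<in> smooth_valued" by (rule lie_derivative_smooth[OF smooth assms(2)])
    show "\<L> Y \<alpha> [] = 0"
      using form_outside[OF Suc.prems, of "[]"] lie_algebra_linear(1)[OF assms(2)] by (simp add: zero_fun_def)
    show "contract Z (\<L> Y \<alpha>) = 0" if "Z \<notin> \<gg>" for Z
      using that by (simp add: contract_def fun_eq_iff)
  next
    fix Z assume Z: "Z \<in> \<gg>"
    show "contract Z (\<L> Y \<alpha>) \<in> alternating_forms h"
      using Suc.IH[of "contract Z \<alpha>"] form_contract[OF Suc.prems] bracket Z
      by (simp add: c form_diff)
    show "contract (k *\<^sub>R Z) (\<L> Y \<alpha>) = k *\<^sub>R contract Z (\<L> Y \<alpha>)" for k
      using Z bracket[OF Z] subspace_scale[OF subspace_lie_algebra Z, of k]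
      by (simp add: c form_head_linear[OF Suc.prems] lie_derivative_scale smooth assms(2)
          smooth_valued_closed lie_bracket_linear(4)[OF Z Z assms(2)] scaleR_diff_right)
    show "contract (Z + W) (\<L> Y \<alpha>) = contract Z (\<L> Y \<alpha>) + contract W (\<L> Y \<alpha>)" if "W \<in> \<gg>" for W
      using Z bracket[OF Z] bracket[OF that] subspace_add[OF subspace_lie_algebra Z that] that
      by (simp add: c form_head_linear[OF Suc.prems] lie_derivative_add smooth assms(2)
          smooth_valued_closed lie_bracket_linear(3)[OF Z that assms(2)])
    show "contract Z (contract Z (\<L> Y \<alpha>)) = 0"
      using form_swap_contract[OF Suc.prems Z bracket[OF Z]] Z
      by (simp add: c contract_linear form_twice[OF Suc.prems] lie_derivative_zero[OF assms(2)])
  qed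
qed

lemma lie_derivative_linear_field:
  assumes "\<alpha> \<in> alternating_forms h" "Y \<in> \<gg>" "Z \<in> \<gg>"
  shows "\<L> (Y + Z) \<alpha> = \<L> Y \<alpha> + \<L> Z \<alpha>" "\<L> (c *\<^sub>R Y) \<alpha> = c *\<^sub>R \<L> Y \<alpha>"
proof -
  note closed = lie_bracket_closed[OF assms(2)] lie_bracket_closed[OF assms(3)]
  show "\<L> (Y + Z) \<alpha> = \<L> Y \<alpha> + \<L> Z \<alpha>"
  proof
    fix Ws show "\<L> (Y + Z) \<alpha> Ws = (\<L> Y \<alpha> + \<L> Z \<alpha>) Ws"
      using assms(1)
    proof (induction Ws arbitrary: \<alpha> h)
      case (Cons W Ws)
      show ?case
      proof (cases "W \<in> \<gg>")
        case True
        have "\<L> (Y + Z) \<alpha> (W # Ws) = \<L> (Y + Z) (contract W \<alpha>) Ws - contract (lie_bracket (Y + Z) W) \<alpha> Ws"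
          using True by (simp add: contract_def)
        also have "\<dots> = (\<L> Y (contract W \<alpha>) + \<L> Z (contract W \<alpha>)) Ws -
            (contract (lie_bracket Y W) \<alpha> + contract (lie_bracket Z W) \<alpha>) Ws"
          by (simp only: Cons.IH[OF form_contract[OF Cons.prems True]] lie_bracket_linear(1)[OF assms(2,3) True]
            form_head_linear(1)[OF Cons.prems closed(1)[OF True] closed(2)[OF True]])
        also have "\<dots> = (\<L> Y \<alpha> + \<L> Z \<alpha>) (W # Ws)"
          using True by (simp add: contract_def)
        finally show ?thesis .
      qed (simp add: fun_eq_iff)
    qed (simp add: fun_eq_iff)
  qed
  show "\<L> (c *\<^sub>R Y) \<alpha> = c *\<^sub>R \<L> Y \<alpha>"
  proof
    fix Ws show "\<L> (c *\<^sub>R Y) \<alpha> Ws = (c *\<^sub>R \<L> Y \<alpha>) Ws"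
      using assms(1)
    proof (induction Ws arbitrary: \<alpha> h)
      case (Cons W Ws)
      show ?case
      proof (cases "W \<in> \<gg>")
        case True
        have "\<L> (c *\<^sub>R Y) \<alpha> (W # Ws) = \<L> (c *\<^sub>R Y) (contract W \<alpha>) Ws - contract (lie_bracket (c *\<^sub>R Y) W) \<alpha> Ws"
          using True by (simp add: contract_def)
        also have "\<dots> = (c *\<^sub>R \<L> Y (contract W \<alpha>)) Ws - (c *\<^sub>R contract (lie_bracket Y W) \<alpha>) Ws"
          by (simp only: Cons.IH[OF form_contract[OF Cons.prems True]] lie_bracket_linear(2)[OF assms(2,2) True]
            form_head_linear(2)[OF Cons.prems closed(1)[OF True]])
        also have "\<dots> = (c *\<^sub>R \<L> Y \<alpha>) (W # Ws)"
          using True by (simp add: contract_def scaleR_apply scaleR_diff_right)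
        finally show ?thesis .
      qed (simp add: scaleR_apply fun_eq_iff)
    qed (simp add: scaleR_apply fun_eq_iff)
  qed
qed

text \<open>By induction on the number of arguments. Moving a contraction \<open>\<iota>\<^sub>W\<close> through \<open>\<L>\<^sub>Y \<L>\<^sub>Z - \<L>\<^sub>Z \<L>\<^sub>Y\<close>, the
  mixed terms cancel and the double brackets combine by the Jacobi identity.\<close>

lemma lie_derivative_commutator:
  assumes "\<alpha> \<in> alternating_forms h" "Y \<in> \<gg>" "Z \<in> \<gg>"
  shows "\<L> (lie_bracket Y Z) \<alpha> = \<L> Y (\<L> Z \<alpha>) - \<L> Z (\<L> Y \<alpha>)"
proof
  fix Ws show "\<L> (lie_bracket Y Z) \<alpha> Ws = (\<L> Y (\<L> Z \<alpha>) - \<L> Z (\<L> Y \<alpha>)) Ws"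
    using assms(1)
  proof (induction Ws arbitrary: \<alpha> h)
    case Nil
    then show ?case by (simp add: lie_bracket_apply)
  next
    case (Cons W Ws)
    show ?case
    proof (cases "W \<in> \<gg>")
      case W: True
      note br = lie_bracket_closed[OF assms(2) W] lie_bracket_closed[OF assms(3) W]
        lie_bracket_closed[OF assms(2,3)]
      note br2 = lie_bracket_closed[OF assms(2) br(2)] lie_bracket_closed[OF assms(3) br(1)]
      note sm = form_smooth[OF Cons.prems]
      have twice: "\<L> U (\<L> V \<alpha>) (W # Ws) = \<L> U (\<L> V (contract W \<alpha>)) Ws
          - \<L> U (contract (lie_bracket V W) \<alpha>) Ws
          - \<L> V (contract (lie_bracket U W) \<alpha>) Ws + contract (lie_bracket V (lie_bracket U W)) \<alpha> Ws"
        if "U \<in> \<gg>" "V \<in> \<gg>" for U V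
      proof -
        have "\<L> U (\<L> V \<alpha>) (W # Ws) = contract W (\<L> U (\<L> V \<alpha>)) Ws"
          by (simp add: contract_def)
        also have "\<dots> = (\<L> U (\<L> V (contract W \<alpha>)) - \<L> U (contract (lie_bracket V W) \<alpha>)
          - (\<L> V (contract (lie_bracket U W) \<alpha>) - contract (lie_bracket V (lie_bracket U W)) \<alpha>)) Ws"
          using that W lie_bracket_closed
          by (simp add: contract_lie_derivative lie_derivative_diff lie_derivative_smooth
              smooth_valued_closed sm)
        finally show ?thesis by (simp add: algebra_simps)
      qed
      have j: "contract (lie_bracket (lie_bracket Y Z) W) \<alpha> =
          contract (lie_bracket Y (lie_bracket Z W)) \<alpha> - contract (lie_bracket Z (lie_bracket Y W)) \<alpha>"
        using form_head_linear(1)[OF Cons.prems br2(1), of "(-1) *\<^sub>R lie_bracket Z (lie_bracket Y W)"]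
          form_head_linear(2)[OF Cons.prems br2(2), of "-1"]
          subspace_scale[OF subspace_lie_algebra br2(2), of "-1"]
        by (simp add: jacobi[OF assms(2,3) W])
      have e: "\<L> (lie_bracket Y Z) \<alpha> (W # Ws) = \<L> (lie_bracket Y Z) (contract W \<alpha>) Ws
          - contract (lie_bracket (lie_bracket Y Z) W) \<alpha> Ws"
        using W by (simp add: contract_def)
      show ?thesis
      proof
        fix x
        show "\<L> (lie_bracket Y Z) \<alpha> (W # Ws) x = (\<L> Y (\<L> Z \<alpha>) - \<L> Z (\<L> Y \<alpha>)) (W # Ws) x"
          using fun_cong[OF e, of x] fun_cong[OF Cons.IH[OF form_contract[OF Cons.prems W]], of x]
            fun_cong[OF twice[OF assms(2,3)], of x] fun_cong[OF twice[OF assms(3,2)], of x]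
          by (simp add: j del: lie_derivative.simps)
      qed
    qed simp
  qed
qed

end

section \<open>The exterior derivative\<close>

lemma nths_omit:
  "nths (Y # Zs) (- {0}) = Zs"
  "nths (Y # Zs) (- {Suc i}) = Y # nths Zs (- {i})"
  "nths (Y # Zs) (- {0, Suc j}) = nths Zs (- {j})"
  "nths (Y # Zs) (- {Suc i, Suc j}) = Y # nths Zs (- {i, j})"
  by (simp_all add: nths_Cons Compl_eq nths_all)

lemma sum_pairs_Suc:
  fixes f :: "nat \<Rightarrow> nat \<Rightarrow> 'b::comm_monoid_add"
  shows "(\<Sum>(i, j) | i < j \<and> j < Suc m. f i j) =
    (\<Sum>j<m. f 0 (Suc j)) + (\<Sum>(i, j) | i < j \<and> j < m. f (Suc i) (Suc j))"
proof -
  let ?P = "\<lambda>m. {(i, j). i < j \<and> j < (m::nat)}"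
  have fin: "finite (?P k)" for k
    by (rule finite_subset[of _ "{..<k} \<times> {..<k}"]) auto
  have eq: "?P (Suc m) = (\<lambda>j. (0, Suc j)) ` {..<m} \<union> (\<lambda>(i, j). (Suc i, Suc j)) ` ?P m"
  proof (rule Set.set_eqI)
    fix p :: "nat \<times> nat"
    obtain i j where p: "p = (i, j)" by (cases p)
    show "p \<in> ?P (Suc m) \<longleftrightarrow> p \<in> (\<lambda>j. (0, Suc j)) ` {..<m} \<union> (\<lambda>(i, j). (Suc i, Suc j)) ` ?P m"
      unfolding p by (cases i; cases j) (auto simp: image_iff)
  qed
  have "(\<Sum>(i, j)\<in>?P (Suc m). f i j) =
    (\<Sum>(i, j)\<in>(\<lambda>j. (0, Suc j)) ` {..<m}. f i j) + (\<Sum>(i, j)\<in>(\<lambda>(i, j). (Suc i, Suc j)) ` ?P m. f i j)"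
    unfolding eq using fin by (intro sum.union_disjoint) auto
  also have "(\<Sum>(i, j)\<in>(\<lambda>j. (0, Suc j)) ` {..<m}. f i j) = (\<Sum>j<m. f 0 (Suc j))"
    by (subst sum.reindex) (auto simp: inj_on_def)
  also have "(\<Sum>(i, j)\<in>(\<lambda>(i, j). (Suc i, Suc j)) ` ?P m. f i j) = (\<Sum>(i, j)\<in>?P m. f (Suc i) (Suc j))"
    by (subst sum.reindex) (auto simp: inj_on_def intro!: sum.cong)
  finally show ?thesis .
qed

context manifold_group
begin

lemma d_Nil: "d \<alpha> [] = 0"
  by (simp add: ext_deriv_def)

lemma d_outside: "\<not> set Ys \<subseteq> \<gg> \<Longrightarrow> d \<alpha> Ys = 0"
  unfolding ext_deriv_def by (rule if_not_P)

lemma d_inside: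
  "set Ys \<subseteq> \<gg> \<Longrightarrow> d \<alpha> Ys = (\<Sum>i<length Ys. (- 1) ^ i *\<^sub>R (Ys ! i) (\<alpha> (nths Ys (- {i})))) +
           (\<Sum>(i, j) | i < j \<and> j < length Ys.
              (- 1) ^ (i + j) *\<^sub>R \<alpha> (lie_bracket (Ys ! i) (Ys ! j) # nths Ys (- {i, j})))"
  unfolding ext_deriv_def by (rule if_P)

lemma d_smooth:
  assumes "\<alpha> \<in> smooth_valued"
  shows "d \<alpha> \<in> smooth_valued"
proof -
  note S = subspace_smooth_functions[OF atlas]
  have "d \<alpha> Ys \<in> F" for Ys
  proof (cases "set Ys \<subseteq> \<gg>")
    case True
    show ?thesis unfolding d_inside[OF True]
    proof (intro F_closed(2) subspace_sum[OF S])
      fix i assume "i \<in> {..<length Ys}"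
      then have "Ys ! i \<in> \<gg>" using True by auto
      then show "(- 1) ^ i *\<^sub>R (Ys ! i) (\<alpha> (nths Ys (- {i}))) \<in> F"
        by (intro F_closed(5) lie_algebra_linear(4))
    qed (auto intro!: F_closed(5) smooth_valuedD[OF assms])
  qed (simp add: d_outside F_closed)
  then show ?thesis by (simp add: smooth_valued_def)
qed

lemma d_add:
  assumes "\<alpha> \<in> smooth_valued" "\<beta> \<in> smooth_valued"
  shows "d (\<alpha> + \<beta>) = d \<alpha> + d \<beta>"
proof
  fix Ys
  show "d (\<alpha> + \<beta>) Ys = (d \<alpha> + d \<beta>) Ys"
  proof (cases "set Ys \<subseteq> \<gg>")
    case True
    have "(Ys ! i) ((\<alpha> + \<beta>) Zs) = (Ys ! i) (\<alpha> Zs) + (Ys ! i) (\<beta> Zs)" if "i < length Ys" for i Zs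
    proof -
      have "Ys ! i \<in> \<gg>" using True that by auto
      then show ?thesis by (simp add: lie_algebraD(3) smooth_valuedD assms fun_eq_iff)
    qed
    then have "(\<Sum>i<length Ys. (- 1) ^ i *\<^sub>R (Ys ! i) ((\<alpha> + \<beta>) (nths Ys (- {i})))) =
      (\<Sum>i<length Ys. (- 1) ^ i *\<^sub>R (Ys ! i) (\<alpha> (nths Ys (- {i})))) +
      (\<Sum>i<length Ys. (- 1) ^ i *\<^sub>R (Ys ! i) (\<beta> (nths Ys (- {i}))))"
      unfolding sum.distrib[symmetric] scaleR_add_right[symmetric] by (intro sum.cong) auto
    moreover have "(\<Sum>(i, j) | i < j \<and> j < length Ys. (- 1) ^ (i + j) *\<^sub>R (\<alpha> + \<beta>) (Zs i j)) =
      (\<Sum>(i, j) | i < j \<and> j < length Ys. (- 1) ^ (i + j) *\<^sub>R \<alpha> (Zs i j)) +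
      (\<Sum>(i, j) | i < j \<and> j < length Ys. (- 1) ^ (i + j) *\<^sub>R \<beta> (Zs i j))" for Zs
      unfolding sum.distrib[symmetric] by (intro sum.cong) (auto simp: scaleR_add_right)
    ultimately show ?thesis
      by (simp only: d_inside[OF True] plus_fun_apply[of "d \<alpha>"] add_ac)
  qed (simp add: d_outside)
qed

lemma d_scale:
  assumes "\<alpha> \<in> smooth_valued"
  shows "d (c *\<^sub>R \<alpha>) = c *\<^sub>R d \<alpha>"
proof
  fix Ys
  show "d (c *\<^sub>R \<alpha>) Ys = (c *\<^sub>R d \<alpha>) Ys"
  proof (cases "set Ys \<subseteq> \<gg>")
    case True
    have "(Ys ! i) ((c *\<^sub>R \<alpha>) Zs) = c *\<^sub>R (Ys ! i) (\<alpha> Zs)" if "i < length Ys" for i Zs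
    proof -
      have "Ys ! i \<in> \<gg>" using True that by auto
      then show ?thesis by (simp add: lie_algebraD(4) smooth_valuedD assms scaleR_apply fun_eq_iff)
    qed
    then have "(\<Sum>i<length Ys. (- 1) ^ i *\<^sub>R (Ys ! i) ((c *\<^sub>R \<alpha>) (nths Ys (- {i})))) =
      c *\<^sub>R (\<Sum>i<length Ys. (- 1) ^ i *\<^sub>R (Ys ! i) (\<alpha> (nths Ys (- {i}))))"
      unfolding scaleR_sum_right by (intro sum.cong) (auto simp: mult.commute)
    moreover have "(\<Sum>(i, j) | i < j \<and> j < length Ys. (- 1) ^ (i + j) *\<^sub>R (c *\<^sub>R \<alpha>) (Zs i j)) =
      c *\<^sub>R (\<Sum>(i, j) | i < j \<and> j < length Ys. (- 1) ^ (i + j) *\<^sub>R \<alpha> (Zs i j))" for Zs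
      unfolding scaleR_sum_right by (intro sum.cong) (auto simp: scaleR_apply mult.commute)
    ultimately show ?thesis
      by (simp only: d_inside[OF True] scaleR_apply[of c "d \<alpha>"] scaleR_add_right)
  qed (simp add: d_outside scaleR_apply)
qed

lemma d_diff:
  assumes "\<alpha> \<in> smooth_valued" "\<beta> \<in> smooth_valued"
  shows "d (\<alpha> - \<beta>) = d \<alpha> - d \<beta>"
  using d_add[of \<alpha> "(-1) *\<^sub>R \<beta>"] d_scale[of \<beta> "-1"] assms
  by (simp add: smooth_valued_closed(4)[of _ "-1", simplified])

lemma d_zero: "d 0 = 0"
  using d_scale[OF smooth_valued_closed(1), of 0] by simp

text \<open>The part of the invariant formula for \<open>d\<close> in which the first argument \<open>Y\<close> takes part. There the
  bracket \<open>[Y, Z\<^sub>j]\<close> stands in front, while \<open>\<L>\<^sub>Y\<close> leaves it in place \<open>j\<close>; moving it costs the sign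
  \<open>(-1)\<^sup>j\<close>.\<close>

lemma lie_derivative_expand:
  assumes "\<alpha> \<in> alternating_forms h" "Y \<in> \<gg>" "set Ws \<subseteq> \<gg>"
  shows "\<L> Y \<alpha> Ws = Y (\<alpha> Ws) + (\<Sum>j<length Ws. (- 1) ^ Suc j *\<^sub>R \<alpha> (lie_bracket Y (Ws ! j) # nths Ws (- {j})))"
  using assms(1,3)
proof (induction Ws arbitrary: \<alpha> h)
  case Nil
  show ?case by simp
next
  case (Cons W Ws)
  let ?c = "contract W \<alpha>"
  have W: "W \<in> \<gg>" "set Ws \<subseteq> \<gg>" using Cons.prems by auto
  have "(\<Sum>j<length (W # Ws). (- 1) ^ Suc j *\<^sub>R \<alpha> (lie_bracket Y ((W # Ws) ! j) # nths (W # Ws) (- {j})))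
    = - \<alpha> (lie_bracket Y W # Ws) +
      (\<Sum>j<length Ws. (- 1) ^ Suc (Suc j) *\<^sub>R \<alpha> (lie_bracket Y (Ws ! j) # W # nths Ws (- {j})))"
    by (simp only: length_Cons sum.lessThan_Suc_shift nths_omit nth_Cons_0 nth_Cons_Suc
      power_Suc power_0 mult_1_right scaleR_minus_left scaleR_one)
  also have "(\<Sum>j<length Ws. (- 1) ^ Suc (Suc j) *\<^sub>R \<alpha> (lie_bracket Y (Ws ! j) # W # nths Ws (- {j}))) =
     (\<Sum>j<length Ws. (- 1) ^ Suc j *\<^sub>R ?c (lie_bracket Y (Ws ! j) # nths Ws (- {j})))"
  proof (rule sum.cong[OF refl])
    fix j assume "j \<in> {..<length Ws}"
    then have "lie_bracket Y (Ws ! j) \<in> \<gg>" using W by (intro lie_bracket_closed[OF assms(2)]) auto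
    from form_swap[OF Cons.prems(1) this W(1)]
    show "(- 1) ^ Suc (Suc j) *\<^sub>R \<alpha> (lie_bracket Y (Ws ! j) # W # nths Ws (- {j})) =
      (- 1) ^ Suc j *\<^sub>R ?c (lie_bracket Y (Ws ! j) # nths Ws (- {j}))"
      by (simp add: contract_def)
  qed
  finally have e: "(\<Sum>j<length (W # Ws). (- 1) ^ Suc j *\<^sub>R \<alpha> (lie_bracket Y ((W # Ws) ! j) # nths (W # Ws) (- {j})))
    = - \<alpha> (lie_bracket Y W # Ws) +
      (\<Sum>j<length Ws. (- 1) ^ Suc j *\<^sub>R ?c (lie_bracket Y (Ws ! j) # nths Ws (- {j})))" .
  have "\<L> Y \<alpha> (W # Ws) = \<L> Y ?c Ws - \<alpha> (lie_bracket Y W # Ws)"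
    using W by simp
  also have "\<L> Y ?c Ws = Y (\<alpha> (W # Ws)) + (\<Sum>j<length Ws. (- 1) ^ Suc j *\<^sub>R ?c (lie_bracket Y (Ws ! j) # nths Ws (- {j})))"
    using Cons.IH[OF form_contract[OF Cons.prems(1) W(1)] W(2)] by (simp only: contract_def[of W \<alpha> Ws])
  finally show ?case
    unfolding e by (simp only: diff_conv_add_uminus add_ac)
qed

text \<open>Cartan's formula. In the invariant formula for \<open>d \<alpha> (Y, Z\<^sub>1, \<dots>)\<close> the terms that differentiate along
  \<open>Y\<close> or contain a bracket with \<open>Y\<close> add up to \<open>\<L>\<^sub>Y \<alpha>\<close>. In the others \<open>Y\<close> is a mere argument of \<open>\<alpha>\<close>:
  shifting the index of a derivative, or moving \<open>Y\<close> past a bracket, gives one minus sign, and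
  they add up to \<open>- d (\<iota>\<^sub>Y \<alpha>)\<close>.\<close>

lemma contract_d:
  assumes "\<alpha> \<in> alternating_forms h" "Y \<in> \<gg>"
  shows "contract Y (d \<alpha>) = \<L> Y \<alpha> - d (contract Y \<alpha>)"
proof
  fix Zs
  let ?c = "contract Y \<alpha>"
  show "contract Y (d \<alpha>) Zs = (\<L> Y \<alpha> - d ?c) Zs"
  proof (cases "set Zs \<subseteq> \<gg>")
    case True
    have YZ: "set (Y # Zs) \<subseteq> \<gg>" using True assms(2) by simp
    have 1: "(\<Sum>i<length (Y # Zs). (- 1) ^ i *\<^sub>R ((Y # Zs) ! i) (\<alpha> (nths (Y # Zs) (- {i})))) =
       Y (\<alpha> Zs) - (\<Sum>i<length Zs. (- 1) ^ i *\<^sub>R (Zs ! i) (?c (nths Zs (- {i}))))"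
      by (simp only: length_Cons sum.lessThan_Suc_shift nths_omit nth_Cons_0 nth_Cons_Suc power_Suc power_0
          scaleR_one contract_def mult_minus1 scaleR_minus_left sum_negf diff_conv_add_uminus)
    have swap: "\<alpha> (lie_bracket (Zs ! i) (Zs ! j) # Y # nths Zs (- {i, j})) =
       - ?c (lie_bracket (Zs ! i) (Zs ! j) # nths Zs (- {i, j}))" if "i < j" "j < length Zs" for i j
    proof -
      have "lie_bracket (Zs ! i) (Zs ! j) \<in> \<gg>" using that True by (intro lie_bracket_closed) auto
      then show ?thesis
        unfolding contract_def by (intro form_swap[OF assms(1) _ assms(2)])
    qed
    have "(\<Sum>(i, j) | i < j \<and> j < length (Y # Zs).
         (- 1) ^ (i + j) *\<^sub>R \<alpha> (lie_bracket ((Y # Zs) ! i) ((Y # Zs) ! j) # nths (Y # Zs) (- {i, j}))) =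
       (\<Sum>j<length Zs. (- 1) ^ Suc j *\<^sub>R \<alpha> (lie_bracket Y (Zs ! j) # nths Zs (- {j}))) +
       (\<Sum>(i, j) | i < j \<and> j < length Zs.
         (- 1) ^ (Suc i + Suc j) *\<^sub>R \<alpha> (lie_bracket (Zs ! i) (Zs ! j) # Y # nths Zs (- {i, j})))"
      by (simp only: length_Cons sum_pairs_Suc nths_omit nth_Cons_0 nth_Cons_Suc add_0_left)
    also have "(\<Sum>(i, j) | i < j \<and> j < length Zs.
         (- 1) ^ (Suc i + Suc j) *\<^sub>R \<alpha> (lie_bracket (Zs ! i) (Zs ! j) # Y # nths Zs (- {i, j}))) =
       - (\<Sum>(i, j) | i < j \<and> j < length Zs.
         (- 1) ^ (i + j) *\<^sub>R ?c (lie_bracket (Zs ! i) (Zs ! j) # nths Zs (- {i, j})))"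
      unfolding sum_negf[symmetric] by (intro sum.cong) (auto simp: swap)
    finally have 2: "(\<Sum>(i, j) | i < j \<and> j < length (Y # Zs).
         (- 1) ^ (i + j) *\<^sub>R \<alpha> (lie_bracket ((Y # Zs) ! i) ((Y # Zs) ! j) # nths (Y # Zs) (- {i, j}))) =
       (\<Sum>j<length Zs. (- 1) ^ Suc j *\<^sub>R \<alpha> (lie_bracket Y (Zs ! j) # nths Zs (- {j}))) +
       - (\<Sum>(i, j) | i < j \<and> j < length Zs.
         (- 1) ^ (i + j) *\<^sub>R ?c (lie_bracket (Zs ! i) (Zs ! j) # nths Zs (- {i, j})))" .
    show ?thesis
      unfolding contract_def[of Y "d \<alpha>"] d_inside[OF YZ] minus_apply[of "\<L> Y \<alpha>"] d_inside[OF True] 1 2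
        lie_derivative_expand[OF assms True]
      by (simp only: diff_conv_add_uminus minus_add_distrib add_ac)
  next
    case False
    then show ?thesis
      using form_outside[OF lie_derivative_form[OF assms], of Zs]
      by (simp add: contract_def d_outside)
  qed
qed

text \<open>The recursive criterion for alternating forms reduces this to Cartan's formula and the induction
  hypothesis. Repetitions are handled by \<open>\<iota>\<^sub>Y \<iota>\<^sub>Y d \<alpha> = \<iota>\<^sub>Y \<L>\<^sub>Y \<alpha> - \<L>\<^sub>Y \<iota>\<^sub>Y \<alpha> + d (\<iota>\<^sub>Y \<iota>\<^sub>Y \<alpha>)\<close>, in which everything
  cancels since \<open>[Y, Y] = 0\<close>.\<close>

lemma d_form:
  assumes "\<alpha> \<in> alternating_forms h"
  shows "d \<alpha> \<in> alternating_forms (Suc h)"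
  using assms
proof (induction h arbitrary: \<alpha>)
  case (Suc h)
  show ?case
  proof (rule form_SucI)
    fix Y assume Y: "Y \<in> \<gg>"
    note sm = form_smooth[OF Suc.prems]
    show "contract Y (d \<alpha>) \<in> alternating_forms (Suc h)"
      unfolding contract_d[OF Suc.prems Y]
      using Suc.IH[of "contract Y \<alpha>"] form_contract[OF Suc.prems Y]
      by (intro form_diff lie_derivative_form Suc.prems Y) simp
    show "contract (c *\<^sub>R Y) (d \<alpha>) = c *\<^sub>R contract Y (d \<alpha>)" for c
      using subspace_scale[OF subspace_lie_algebra Y, of c]
      by (simp only: contract_d[OF Suc.prems] Y lie_derivative_linear_field(2)[OF Suc.prems Y Y]
        form_head_linear(2)[OF Suc.prems Y] d_scale smooth_valued_closed sm scaleR_diff_right)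
    show "contract (Y + Z) (d \<alpha>) = contract Y (d \<alpha>) + contract Z (d \<alpha>)" if Z: "Z \<in> \<gg>" for Z
      using subspace_add[OF subspace_lie_algebra Y Z]
      by (simp add: contract_d[OF Suc.prems] Y Z lie_derivative_linear_field(1)[OF Suc.prems Y Z]
        form_head_linear(1)[OF Suc.prems Y Z] d_add smooth_valued_closed sm)
    show "contract Y (contract Y (d \<alpha>)) = 0"
      using contract_d[OF form_contract[OF Suc.prems Y] Y] Y
      by (simp add: contract_d[OF Suc.prems] contract_linear contract_lie_derivative
          form_twice[OF Suc.prems] lie_bracket_self d_zero
          form_head_linear(2)[OF Suc.prems Y, of 0, simplified])
  qed (use d_Nil d_outside d_smooth form_smooth[OF Suc.prems] in \<open>simp_all add: contract_def fun_eq_iff\<close>)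
next
  case 0
  have c: "contract Y (d \<alpha>) = \<L> Y \<alpha>" if "Y \<in> \<gg>" for Y
    using contract_d[OF 0 that] form_0_contract[OF 0] by (simp add: d_zero)
  show ?case
  proof (rule form_SucI)
    fix Y assume Y: "Y \<in> \<gg>"
    show "contract Y (d \<alpha>) \<in> alternating_forms 0"
      using lie_derivative_form[OF 0 Y] by (simp add: c Y)
    then show "contract Y (contract Y (d \<alpha>)) = 0"
      by (rule form_0_contract)
    show "contract (k *\<^sub>R Y) (d \<alpha>) = k *\<^sub>R contract Y (d \<alpha>)" for k
      using subspace_scale[OF subspace_lie_algebra Y, of k]
      by (simp add: c Y lie_derivative_linear_field(2)[OF 0 Y Y])
    show "contract (Y + Z) (d \<alpha>) = contract Y (d \<alpha>) + contract Z (d \<alpha>)" if Z: "Z \<in> \<gg>" for Z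
      using subspace_add[OF subspace_lie_algebra Y Z]
      by (simp add: c Y Z lie_derivative_linear_field(1)[OF 0 Y Z])
  qed (use d_Nil d_outside d_smooth form_smooth[OF 0] in \<open>simp_all add: contract_def fun_eq_iff\<close>)
qed

text \<open>By induction on the number of arguments: after contraction with \<open>W\<close> and use of Cartan's formula on
  both sides, the difference consists, up to sign, of \<open>[\<L>\<^sub>W, \<L>\<^sub>Y] + \<L>\<^bsub>[Y,W]\<^esub>\<close>, which is zero, and of the same
  commutator of \<open>d\<close> and \<open>\<L>\<^sub>Y\<close> applied to \<open>\<iota>\<^sub>W \<alpha>\<close>.\<close>

lemma d_lie_derivative:
  assumes "\<alpha> \<in> alternating_forms h" "Y \<in> \<gg>"
  shows "d (\<L> Y \<alpha>) = \<L> Y (d \<alpha>)"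
proof
  fix Ws show "d (\<L> Y \<alpha>) Ws = \<L> Y (d \<alpha>) Ws"
    using assms(1)
  proof (induction Ws arbitrary: \<alpha> h)
    case Nil
    then show ?case using lie_algebra_linear(1)[OF assms(2)] by (simp add: d_Nil zero_fun_def)
  next
    case (Cons W Ws)
    show ?case
    proof (cases "W \<in> \<gg>")
      case W: True
      note br = lie_bracket_closed[OF assms(2) W]
      note sm = form_smooth[OF Cons.prems]
      note closed = smooth_valued_closed lie_derivative_smooth d_smooth sm W br assms(2)
      have 1: "contract W (d (\<L> Y \<alpha>)) = \<L> W (\<L> Y \<alpha>) - (d (\<L> Y (contract W \<alpha>)) - d (contract (lie_bracket Y W) \<alpha>))"
        by (simp add: contract_d[OF lie_derivative_form[OF Cons.prems assms(2)] W]
          contract_lie_derivative[OF W] d_diff closed)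
      have 2: "contract W (\<L> Y (d \<alpha>)) = \<L> Y (\<L> W \<alpha>) - \<L> Y (d (contract W \<alpha>))
          - ((\<L> Y (\<L> W \<alpha>) - \<L> W (\<L> Y \<alpha>)) - d (contract (lie_bracket Y W) \<alpha>))"
        by (simp add: contract_lie_derivative[OF W] contract_d[OF Cons.prems] W br
          lie_derivative_diff closed lie_derivative_commutator[OF Cons.prems assms(2) W])
      have "contract W (d (\<L> Y \<alpha>)) Ws = contract W (\<L> Y (d \<alpha>)) Ws"
        unfolding 1 2 using Cons.IH[OF form_contract[OF Cons.prems W]]
        by (simp add: fun_eq_iff)
      then show ?thesis by (simp only: contract_def)
    qed (simp add: d_outside)
  qed
qed

lemma d_d:
  assumes "\<alpha> \<in> alternating_forms h"
  shows "d (d \<alpha>) = 0"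
proof
  fix Ws show "d (d \<alpha>) Ws = 0 Ws"
    using assms
  proof (induction Ws arbitrary: \<alpha> h)
    case Nil
    show ?case by (simp add: d_Nil zero_fun_def)
  next
    case (Cons W Ws)
    show ?case
    proof (cases "W \<in> \<gg>")
      case W: True
      note sm = form_smooth[OF Cons.prems]
      note closed = smooth_valued_closed lie_derivative_smooth d_smooth sm W
      have "contract W (d (d \<alpha>)) = \<L> W (d \<alpha>) - (d (\<L> W \<alpha>) - d (d (contract W \<alpha>)))"
        by (simp add: contract_d[OF d_form[OF Cons.prems] W] contract_d[OF Cons.prems W] d_diff closed)
      also have "\<dots> = d (d (contract W \<alpha>))"
        by (simp add: d_lie_derivative[OF Cons.prems W])
      finally have eq: "contract W (d (d \<alpha>)) = d (d (contract W \<alpha>))" .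
      have "d (d \<alpha>) (W # Ws) = contract W (d (d \<alpha>)) Ws"
        by (simp only: contract_def)
      also have "\<dots> = d (d (contract W \<alpha>)) Ws"
        by (simp only: eq)
      finally show ?thesis
        by (simp only: Cons.IH[OF form_contract[OF Cons.prems W]] zero_fun_apply)
    qed (simp add: d_outside)
  qed
qed

end

section \<open>Direct sums given by projections\<close>

lemma family_sum_superset:
  assumes "finite T" "{i. v i \<noteq> 0} \<subseteq> T"
  shows "family_sum v = sum v T"
  unfolding family_sum_def using assms by (intro sum.mono_neutral_left) auto

lemma family_sum_add:
  assumes "finite {i. v i \<noteq> 0}" "finite {i. w i \<noteq> 0}"
  shows "family_sum (\<lambda>i. v i + w i) = family_sum v + family_sum w"
proof -
  let ?T = "{i. v i \<noteq> 0} \<union> {i. w i \<noteq> 0}"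
  have "finite ?T" using assms by simp
  moreover have "{i. v i + w i \<noteq> 0} \<subseteq> ?T" by auto
  ultimately show ?thesis
    by (simp add: family_sum_superset[of ?T] sum.distrib)
qed

lemma family_sum_scale:
  fixes v :: "'i \<Rightarrow> 'c::real_vector"
  assumes "finite {i. v i \<noteq> 0}"
  shows "family_sum (\<lambda>i. c *\<^sub>R v i) = c *\<^sub>R family_sum v"
  by (subst (1 2) family_sum_superset[OF assms]) (auto simp: scaleR_sum_right)

lemma family_sum_single:
  assumes "\<And>i. i \<noteq> j \<Longrightarrow> v i = 0"
  shows "family_sum v = v j"
proof -
  have "family_sum v = sum v {j}" using assms by (intro family_sum_superset) auto
  then show ?thesis by simp
qed

text \<open>The component and weight maps below are given by inverse functions, hence meaningful, and linear,
  only on the direct sum; this is linearity restricted to such a subspace.\<close>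

definition linear_on :: "'c::real_vector set \<Rightarrow> ('c \<Rightarrow> 'd::real_vector) \<Rightarrow> bool" where
  "linear_on C f \<longleftrightarrow> (\<forall>x\<in>C. \<forall>y\<in>C. f (x + y) = f x + f y) \<and> (\<forall>c. \<forall>x\<in>C. f (c *\<^sub>R x) = c *\<^sub>R f x)"

lemma linear_onD:
  assumes "linear_on C f"
  shows "x \<in> C \<Longrightarrow> y \<in> C \<Longrightarrow> f (x + y) = f x + f y" "x \<in> C \<Longrightarrow> f (c *\<^sub>R x) = c *\<^sub>R f x"
  using assms by (auto simp: linear_on_def)

lemma linear_on_0: "linear_on C f \<Longrightarrow> 0 \<in> C \<Longrightarrow> f 0 = 0"
  using linear_onD(2)[of C f 0 0] by simp

lemma linear_on_span_eq:
  assumes "linear_on (span S) f" "linear_on (span S) g" "\<And>x. x \<in> S \<Longrightarrow> f x = g x" "x \<in> span S"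
  shows "f x = g x"
proof -
  have "x \<in> span S \<and> f x = g x"
    using assms(4)
  proof (induction rule: span_induct_alt)
    case base
    show ?case using linear_on_0[OF assms(1) span_zero] linear_on_0[OF assms(2) span_zero] by (simp add: span_zero)
  next
    case (step c x y)
    then have "x \<in> span S" "c *\<^sub>R x \<in> span S" by (auto simp: span_base span_scale)
    with step show ?case
      using assms(3)[of x] by (simp add: linear_onD[OF assms(1)] linear_onD[OF assms(2)] span_add)
  qed
  then show ?thesis by simp
qed

lemma linear_on_compose:
  assumes "linear_on C f" "linear_on C g" "\<And>x. x \<in> C \<Longrightarrow> f x \<in> C"
  shows "linear_on C (\<lambda>x. g (f x))"
  using assms by (simp add: linear_on_def)

lemma linear_on_sum:
  assumes "\<And>i. i \<in> I \<Longrightarrow> linear_on C (f i)"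
  shows "linear_on C (\<lambda>x. \<Sum>i\<in>I. f i x)"
  using assms by (simp add: linear_on_def sum.distrib scaleR_sum_right)

lemma linear_on_const_0: "linear_on C (\<lambda>x. 0)"
  by (simp add: linear_on_def)

text \<open>Subspaces with linear maps that act as the identity on their own subspace and as zero on the others.
  Their existence forces the sum of the subspaces to be direct, and they compute its components.\<close>

locale graded_projections =
  fixes M :: "'i \<Rightarrow> 'c::real_vector set" and P :: "'i \<Rightarrow> 'c \<Rightarrow> 'c"
  assumes subspace_M: "subspace (M i)"
    and P_add: "P i (x + y) = P i x + P i y" and P_scale: "P i (c *\<^sub>R x) = c *\<^sub>R P i x"
    and P_same: "x \<in> M i \<Longrightarrow> P i x = x"
    and P_other: "x \<in> M i \<Longrightarrow> j \<noteq> i \<Longrightarrow> P j x = 0"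
begin

lemma P_zero: "P i 0 = 0"
  using P_scale[of i 0 0] by simp

lemma P_sum: "P i (sum f T) = (\<Sum>j\<in>T. P i (f j))"
  by (induction T rule: infinite_finite_induct) (simp_all add: P_zero P_add)

text \<open>Each property holds on generators and is preserved under linear combinations. In particular a
  vector is recovered from its components.\<close>

lemma span_projections:
  assumes "x \<in> span (\<Union>i\<in>I. M i)"
  shows "P i x \<in> M i" "i \<notin> I \<Longrightarrow> P i x = 0" "finite {i. P i x \<noteq> 0}" "family_sum (\<lambda>i. P i x) = x"
proof -
  have "(\<forall>i. P i x \<in> M i) \<and> (\<forall>i. i \<notin> I \<longrightarrow> P i x = 0) \<and> finite {i. P i x \<noteq> 0} \<and> family_sum (\<lambda>i. P i x) = x"
    using assms
  proof (induction rule: span_induct_alt)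
    case base
    show ?case by (simp add: P_zero subspace_0[OF subspace_M] family_sum_def)
  next
    case (step c x y)
    then obtain j where j: "j \<in> I" "x \<in> M j" by auto
    have Px: "P i x = (if i = j then x else 0)" for i
      using P_same[OF j(2)] P_other[OF j(2)] by auto
    have fx: "finite {i. P i x \<noteq> 0}" by (rule finite_subset[of _ "{j}"]) (auto simp: Px)
    have fcx: "finite {i. c *\<^sub>R P i x \<noteq> 0}" by (rule finite_subset[OF _ fx]) auto
    have sx: "family_sum (\<lambda>i. P i x) = x"
      using family_sum_single[of j "\<lambda>i. P i x"] by (simp add: Px)
    have fin: "finite {i. P i (c *\<^sub>R x + y) \<noteq> 0}"
      by (rule finite_subset[of _ "{i. c *\<^sub>R P i x \<noteq> 0} \<union> {i. P i y \<noteq> 0}"])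
        (use fcx step in \<open>auto simp: P_add P_scale\<close>)
    have "family_sum (\<lambda>i. P i (c *\<^sub>R x + y)) = c *\<^sub>R x + y"
      unfolding P_add P_scale using family_sum_add[OF fcx, of "\<lambda>i. P i y"] family_sum_scale[OF fx, of c] sx step
      by simp
    moreover have "P i (c *\<^sub>R x + y) \<in> M i" for i
      using step j subspace_0[OF subspace_M, of i]
      by (auto simp: P_add P_scale Px intro!: subspace_add[OF subspace_M] subspace_scale[OF subspace_M])
    moreover have "P i (c *\<^sub>R x + y) = 0" if "i \<notin> I" for i
      using step j that by (auto simp: P_add P_scale Px)
    ultimately show ?case using fin by blast
  qed
  then show "P i x \<in> M i" "i \<notin> I \<Longrightarrow> P i x = 0" "finite {i. P i x \<noteq> 0}" "family_sum (\<lambda>i. P i x) = x"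
    by auto
qed

lemma projection_family_sum:
  assumes "v \<in> finsupp_families I M"
  shows "P i (family_sum v) = v i"
proof -
  have fin: "finite {j. v j \<noteq> 0}"
    using assms by (simp add: finsupp_families_def)
  have vM: "v j \<in> M j" for j
    using assms subspace_0[OF subspace_M, of j] by (cases "j \<in> I") (auto simp: finsupp_families_def)
  have P: "P i (v j) = (if j = i then v i else 0)" for j
    using P_same[OF vM] P_other[OF vM] by auto
  have "family_sum v = sum v (insert i {j. v j \<noteq> 0})"
    using fin by (intro family_sum_superset) auto
  then have "P i (family_sum v) = (\<Sum>j\<in>insert i {j. v j \<noteq> 0}. if j = i then v i else 0)"
    by (simp only: P_sum P)
  also have "\<dots> = v i" using fin by (subst sum.delta) auto
  finally show ?thesis .
qed

lemma direct_sum_span: "is_direct_sum scaleR I M (span (\<Union>i\<in>I. M i))"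
proof -
  have "bij_betw family_sum (finsupp_families I M) (span (\<Union>i\<in>I. M i))"
  proof (rule bij_betw_byWitness[where f' = "\<lambda>x i. P i x"])
    show "\<forall>v\<in>finsupp_families I M. (\<lambda>i. P i (family_sum v)) = v"
      by (simp add: projection_family_sum fun_eq_iff)
    show "\<forall>x\<in>span (\<Union>i\<in>I. M i). family_sum (\<lambda>i. P i x) = x"
      by (simp add: span_projections)
    show "family_sum ` finsupp_families I M \<subseteq> span (\<Union>i\<in>I. M i)"
    proof clarify
      fix v assume v: "v \<in> finsupp_families I M"
      show "family_sum v \<in> span (\<Union>i\<in>I. M i)"
        unfolding family_sum_def
      proof (rule span_sum)
        fix i assume "i \<in> {i. v i \<noteq> 0}"
        then have "i \<in> I" "v i \<in> M i" using v by (auto simp: finsupp_families_def)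
        then show "v i \<in> span (\<Union>i\<in>I. M i)" by (auto intro: span_base)
      qed
    qed
    show "(\<lambda>x i. P i x) ` span (\<Union>i\<in>I. M i) \<subseteq> finsupp_families I M"
      by (auto simp: finsupp_families_def span_projections)
  qed
  then show ?thesis
    using subspace_span subspace_M by (simp add: is_direct_sum_def subspace_raw_def)
qed

lemma component_eq:
  assumes "x \<in> span (\<Union>i. M i)"
  shows "component M i x = P i x"
proof -
  have bij: "bij_betw family_sum (finsupp_families UNIV M) (span (\<Union>i. M i))"
    using direct_sum_span[of UNIV] by (simp add: is_direct_sum_def)
  have "(\<lambda>i. P i x) \<in> finsupp_families UNIV M"
    using span_projections[OF assms] by (simp add: finsupp_families_def)
  then have "inv_into (finsupp_families UNIV M) family_sum x = (\<lambda>i. P i x)"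
    using bij_betw_imp_inj_on[OF bij] span_projections(4)[OF assms] by (intro inv_into_f_eq) auto
  then show ?thesis by (simp add: component_def)
qed

end

section \<open>Multicomplexes from differentials that raise the weight\<close>

text \<open>The first index is the weight, and the sum of both indices is the degree. Homogeneous elements
  generate, so weights and the square of the differential are controlled on them.\<close>

locale weighted_differential = graded_projections M P
  for M :: "int \<times> int \<Rightarrow> 'c::real_vector set" and P +
  fixes D :: "'c \<Rightarrow> 'c" and s :: nat
  assumes D_linear: "linear_on (span (\<Union>p. M p)) D"
    and D_degree: "x \<in> M (a, b) \<Longrightarrow> D x \<in> span (\<Union>p\<in>{(a', b'). a' + b' = a + b + 1}. M p)"
    and D_weight: "x \<in> M (a, b) \<Longrightarrow> \<not> (a \<le> c \<and> c \<le> a + int s) \<Longrightarrow> P (c, e) (D x) = 0"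
    and D_square: "x \<in> M p \<Longrightarrow> D (D x) = 0"
begin

definition total :: "'c set" where "total = span (\<Union>p. M p)"

abbreviation "R \<equiv> raising_part M D"

lemma subspace_total: "subspace total"
  by (simp add: total_def)

lemma M_in_total: "M p \<subseteq> total"
  unfolding total_def using span_superset[of "\<Union>p. M p"] by blast

lemma D_in_total: "x \<in> M p \<Longrightarrow> D x \<in> total"
proof -
  assume "x \<in> M p"
  then have "D x \<in> span (\<Union>q\<in>{(a', b'). a' + b' = fst p + snd p + 1}. M q)"
    using D_degree[of x "fst p" "snd p"] by simp
  then show "D x \<in> total"
    unfolding total_def using span_mono[of "\<Union>q\<in>{(a', b'). a' + b' = fst p + snd p + 1}. M q" "\<Union>p. M p"] by blast
qed

lemma weight_part_eq:
  "x \<in> total \<Longrightarrow> weight_part M p x = family_sum (\<lambda>b. P (p, b) x)"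
  by (simp add: weight_part_def component_eq total_def)

lemma finite_weight_supports:
  assumes "x \<in> total"
  shows "finite {b. P (p, b) x \<noteq> 0}" "finite {p. weight_part M p x \<noteq> 0}"
proof -
  have fin: "finite {i. P i x \<noteq> 0}" using span_projections(3)[of x UNIV] assms by (simp add: total_def)
  show "finite {b. P (p, b) x \<noteq> 0}"
    by (rule finite_subset[OF _ finite_imageI[OF fin, of snd]]) (force simp: image_iff)
  show "finite {p. weight_part M p x \<noteq> 0}"
  proof (rule finite_subset[OF _ finite_imageI[OF fin, of fst]], clarify)
    fix p assume "weight_part M p x \<noteq> 0"
    then obtain b where "P (p, b) x \<noteq> 0"
      unfolding weight_part_eq[OF assms] family_sum_def by (metis (mono_tags, lifting) mem_Collect_eq sum.neutral)
    then show "p \<in> fst ` {i. P i x \<noteq> 0}" by force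
  qed
qed

lemma weight_part_linear: "linear_on total (weight_part M p)"
  unfolding linear_on_def
proof (intro conjI ballI allI)
  fix x y assume "x \<in> total" "y \<in> total"
  then show "weight_part M p (x + y) = weight_part M p x + weight_part M p y"
    using subspace_add[OF subspace_total]
    by (simp add: weight_part_eq P_add family_sum_add finite_weight_supports)
next
  fix c x assume "x \<in> total"
  then show "weight_part M p (c *\<^sub>R x) = c *\<^sub>R weight_part M p x"
    using subspace_scale[OF subspace_total]
    by (simp add: weight_part_eq P_scale family_sum_scale finite_weight_supports)
qed

lemma P_in_total: "x \<in> total \<Longrightarrow> P i x \<in> total"
  using span_projections(1)[of x UNIV i] M_in_total[of i] by (auto simp: total_def)

lemma weight_part_in_total: "x \<in> total \<Longrightarrow> weight_part M p x \<in> total"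
  unfolding weight_part_eq family_sum_def
  by (intro subspace_sum[OF subspace_total] P_in_total)

text \<open>In a fixed total degree \<open>h\<close> the weight \<open>p\<close> determines the second index \<open>h - p\<close>, so the weight part
  is a single component.\<close>

lemma weight_part_degree:
  assumes "x \<in> span (\<Union>p\<in>{(a, b). a + b = h}. M p)"
  shows "weight_part M p x = P (p, h - p) x"
proof -
  have "x \<in> total"
    unfolding total_def using assms span_mono[of "\<Union>p\<in>{(a, b). a + b = h}. M p" "\<Union>p. M p"] by blast
  moreover have "P (p, b) x = 0" if "b \<noteq> h - p" for b
    using span_projections(2)[OF assms, of "(p, b)"] that by auto
  ultimately show ?thesis
    unfolding weight_part_eq[OF \<open>x \<in> total\<close>] by (intro family_sum_single)
qed

lemma weight_part_homogeneous:
  assumes "x \<in> M (a, b)"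
  shows "weight_part M p x = (if p = a then x else 0)"
proof -
  have "x \<in> span (\<Union>p\<in>{(a', b'). a' + b' = a + b}. M p)"
    using assms by (intro span_base) auto
  then have "weight_part M p x = P (p, a + b - p) x" by (rule weight_part_degree)
  then show ?thesis using P_same[OF assms] P_other[OF assms] by auto
qed

lemma D_total: "x \<in> total \<Longrightarrow> D x \<in> total"
proof -
  assume "x \<in> total"
  then have "x \<in> total \<and> D x \<in> total"
    unfolding total_def
  proof (induction rule: span_induct_alt)
    case base
    show ?case using linear_on_0[OF D_linear span_zero] by (simp add: span_zero)
  next
    case (step c x y)
    then obtain p where p: "x \<in> M p" by auto
    have x: "x \<in> span (\<Union>p. M p)" "D x \<in> span (\<Union>p. M p)"
      using subsetD[OF M_in_total p] D_in_total[OF p] by (simp_all add: total_def)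
    then show ?case
      using step by (simp add: linear_onD[OF D_linear] span_add span_scale)
  qed
  then show "D x \<in> total" ..
qed

lemma D_linear_total: "linear_on total D"
  using D_linear by (simp add: total_def)

lemma raising_summand_linear: "linear_on total (\<lambda>x. weight_part M q (D (weight_part M p x)))"
proof -
  have "linear_on total (\<lambda>x. D (weight_part M p x))"
    by (rule linear_on_compose[OF weight_part_linear D_linear_total weight_part_in_total])
  then show ?thesis
    by (rule linear_on_compose[OF _ weight_part_linear]) (intro D_total weight_part_in_total)
qed

lemma raising_part_eq:
  assumes "x \<in> total"
  shows "R i x = family_sum (\<lambda>p. weight_part M (p + int i) (D (weight_part M p x)))"
    and "finite {p. weight_part M (p + int i) (D (weight_part M p x)) \<noteq> 0}"
proof -
  have sub: "{p. weight_part M (p + int i) (D (weight_part M p x)) \<noteq> 0} \<subseteq> {p. weight_part M p x \<noteq> 0}"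
    using linear_on_0[OF D_linear_total] linear_on_0[OF weight_part_linear] subspace_0[OF subspace_total] by auto
  show "finite {p. weight_part M (p + int i) (D (weight_part M p x)) \<noteq> 0}"
    by (rule finite_subset[OF sub finite_weight_supports(2)[OF assms]])
  show "R i x = family_sum (\<lambda>p. weight_part M (p + int i) (D (weight_part M p x)))"
    unfolding raising_part_def
    by (rule family_sum_superset[OF finite_weight_supports(2)[OF assms] sub, symmetric])
qed

lemma raising_part_linear: "linear_on total (R i)"
  unfolding linear_on_def
proof (intro conjI ballI allI)
  fix x y assume "x \<in> total" "y \<in> total"
  then show "R i (x + y) = R i x + R i y"
    using subspace_add[OF subspace_total] linear_onD(1)[OF raising_summand_linear]
    by (simp add: raising_part_eq family_sum_add)
next
  fix c x assume "x \<in> total"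
  then show "R i (c *\<^sub>R x) = c *\<^sub>R R i x"
    using subspace_scale[OF subspace_total] linear_onD(2)[OF raising_summand_linear]
    by (simp add: raising_part_eq family_sum_scale)
qed

lemma raising_part_total: "x \<in> total \<Longrightarrow> R i x \<in> total"
  unfolding raising_part_def
  by (intro subspace_sum[OF subspace_total] weight_part_in_total D_total)

text \<open>On a homogeneous element the sum over all weights in the definition of the raising part has one
  nonzero term, and what remains is one component of \<open>D x\<close>.\<close>

lemma raising_part_homogeneous:
  assumes "x \<in> M (a, b)"
  shows "R i x = P (a + int i, b + 1 - int i) (D x)"
proof -
  have x: "x \<in> total" using assms M_in_total by blast
  have 0: "weight_part M q (D 0) = 0" for q
    using linear_on_0[OF D_linear_total] linear_on_0[OF weight_part_linear] subspace_0[OF subspace_total] by simp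
  have "R i x = weight_part M (a + int i) (D (weight_part M a x))"
    unfolding raising_part_eq(1)[OF x]
    by (rule family_sum_single[where j = a and v = "\<lambda>p. weight_part M (p + int i) (D (weight_part M p x))"])
      (simp add: weight_part_homogeneous[OF assms] 0)
  also have "\<dots> = P (a + int i, a + b + 1 - (a + int i)) (D x)"
    using weight_part_degree[OF D_degree[OF assms]] by (simp add: weight_part_homogeneous[OF assms])
  finally show ?thesis by (simp add: algebra_simps)
qed

lemma raising_part_bidegree:
  assumes "x \<in> M (a, b)"
  shows "R i x \<in> M (a + int i, b + 1 - int i)"
  using span_projections(1)[OF D_degree[OF assms]] by (simp add: raising_part_homogeneous[OF assms])

lemma raising_part_vanishes:
  assumes "i > s" "x \<in> total"
  shows "R i x = 0"
proof (rule linear_on_span_eq[OF _ _ _ assms(2)[unfolded total_def]])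
  show "linear_on (span (\<Union>p. M p)) (R i)" using raising_part_linear by (simp add: total_def)
  show "linear_on (span (\<Union>p. M p)) (\<lambda>x. 0)" by (rule linear_on_const_0)
  fix x assume "x \<in> (\<Union>p. M p)"
  then obtain a b where "x \<in> M (a, b)" by auto
  then show "R i x = 0"
    using assms(1) by (simp add: raising_part_homogeneous D_weight)
qed

text \<open>The bound \<open>N\<close> may exceed \<open>s\<close>; the proof of the quadratic relations needs the sum up to the larger of
  \<open>s\<close> and \<open>n\<close>.\<close>

lemma D_homogeneous_decomposition:
  assumes "x \<in> M (a, b)" "s \<le> N"
  shows "D x = (\<Sum>i\<le>N. R i x)"
proof -
  let ?f = "\<lambda>i::nat. (a + int i, b + 1 - int i)"
  have "D x = family_sum (\<lambda>q. P q (D x))"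
    using span_projections(4)[OF D_degree[OF assms(1)]] by simp
  also have "\<dots> = sum (\<lambda>q. P q (D x)) (?f ` {..N})"
  proof (rule family_sum_superset)
    show "{q. P q (D x) \<noteq> 0} \<subseteq> ?f ` {..N}"
    proof
      fix q assume q: "q \<in> {q. P q (D x) \<noteq> 0}"
      obtain c e where ce: "q = (c, e)" by (cases q)
      have "c + e = a + b + 1"
        using span_projections(2)[OF D_degree[OF assms(1)], of q] q ce by auto
      moreover have "a \<le> c" "c \<le> a + int s"
        using D_weight[OF assms(1), of c e] q ce by auto
      ultimately have "q = ?f (nat (c - a))" "nat (c - a) \<le> N"
        using ce assms(2) by auto
      then show "q \<in> ?f ` {..N}" by blast
    qed
  qed simp
  also have "\<dots> = (\<Sum>i\<le>N. R i x)"
    by (subst sum.reindex) (auto simp: inj_on_def raising_part_homogeneous[OF assms(1)])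
  finally show ?thesis .
qed

lemma D_decomposition:
  assumes "x \<in> total"
  shows "D x = (\<Sum>i\<le>s. R i x)"
proof (rule linear_on_span_eq[OF D_linear _ _ assms[unfolded total_def]])
  show "linear_on (span (\<Union>p. M p)) (\<lambda>x. \<Sum>i\<le>s. R i x)"
    using raising_part_linear by (intro linear_on_sum) (simp add: total_def)
  fix x assume "x \<in> (\<Union>p. M p)"
  then obtain a b where "x \<in> M (a, b)" by auto
  then show "D x = (\<Sum>i\<le>s. R i x)" by (rule D_homogeneous_decomposition) simp
qed

text \<open>The sum is the component of weight \<open>a + n\<close> of \<open>D D x\<close>. The terms of \<open>D x\<close> of weight above \<open>a + n\<close>
  are missing from the sum, but they do not contribute, since \<open>D\<close> does not lower the weight.\<close>

lemma raising_relation_homogeneous: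
  assumes x: "x \<in> M (a, b)"
  shows "(\<Sum>j\<le>n. R (n - j) (R j x)) = 0"
proof -
  let ?N = "max n s" and ?Q = "P (a + int n, b + 2 - int n)"
  have R: "R j x \<in> M (a + int j, b + 1 - int j)" for j by (rule raising_part_bidegree[OF x])
  have RC: "R j x \<in> total" for j using raising_part_total M_in_total x by blast
  have above: "?Q (D (R j x)) = 0" if "n < j" for j
    using D_weight[OF R] that by simp
  have below: "R (n - j) (R j x) = ?Q (D (R j x))" if "j \<le> n" for j
    unfolding raising_part_homogeneous[OF R] using that by (simp add: of_nat_diff algebra_simps)
  have D_sum: "D (\<Sum>j\<in>T. R j x) = (\<Sum>j\<in>T. D (R j x))" for T
  proof (induction T rule: infinite_finite_induct)
    case (insert j T)
    have "(\<Sum>j\<in>T. R j x) \<in> total" by (rule subspace_sum[OF subspace_total RC])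
    with insert show ?case
      by (simp add: linear_onD(1)[OF D_linear_total RC])
  qed (simp_all add: linear_on_0[OF D_linear_total] subspace_0[OF subspace_total])
  have "(\<Sum>j\<le>n. R (n - j) (R j x)) = (\<Sum>j\<le>n. ?Q (D (R j x)))"
    by (intro sum.cong) (auto simp: below)
  also have "\<dots> = (\<Sum>j\<le>?N. ?Q (D (R j x)))"
    by (rule sum.mono_neutral_left) (auto simp: above)
  also have "\<dots> = ?Q (D (\<Sum>j\<le>?N. R j x))"
    by (simp add: P_sum D_sum)
  also have "\<dots> = 0"
    using D_homogeneous_decomposition[OF x, of ?N] D_square[OF x] by (simp add: P_zero)
  finally show ?thesis .
qed

lemma raising_relation:
  assumes "x \<in> total"
  shows "(\<Sum>(i, j) | i + j = n. R i (R j x)) = 0"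
proof -
  have "(\<Sum>(i, j) | i + j = n. R i (R j x)) = (\<Sum>j\<le>n. R (n - j) (R j x))"
    by (rule sum.reindex_bij_witness[of _ "\<lambda>j. (n - j, j)" snd]) auto
  also have "\<dots> = 0"
  proof (rule linear_on_span_eq[OF _ _ _ assms[unfolded total_def]])
    have "linear_on total (\<lambda>x. \<Sum>j\<le>n. R (n - j) (R j x))"
      by (rule linear_on_sum) (rule linear_on_compose[OF raising_part_linear raising_part_linear raising_part_total])
    then show "linear_on (span (\<Union>p. M p)) (\<lambda>x. \<Sum>j\<le>n. R (n - j) (R j x))" by (simp add: total_def)
    show "linear_on (span (\<Union>p. M p)) (\<lambda>x. 0)" by (rule linear_on_const_0)
    fix x assume "x \<in> (\<Union>p. M p)"
    then obtain a b where "x \<in> M (a, b)" by auto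
    then show "(\<Sum>j\<le>n. R (n - j) (R j x)) = 0" by (rule raising_relation_homogeneous)
  qed
  finally show ?thesis .
qed

lemma multicomplex_raising_part: "multicomplex scaleR total M R"
  unfolding multicomplex_def
proof (intro conjI allI ballI)
  show "module (scaleR :: real \<Rightarrow> 'c \<Rightarrow> 'c)" by (rule real_vector.module_axioms)
  show "is_direct_sum scaleR UNIV M total" unfolding total_def by (rule direct_sum_span)
qed (use raising_part_linear raising_part_bidegree raising_relation in \<open>auto simp: linear_on_def\<close>)

end

section \<open>Weights on a Carnot group\<close>

locale carnot_frame = manifold_group G A
  for G :: "('g::topological_space) monoid" and A :: "('g, 'e::euclidean_space) chart set" +
  fixes V :: "nat \<Rightarrow> 'g vfield set" and s n :: nat
    and ip :: "'g vfield \<Rightarrow> 'g vfield \<Rightarrow> real" and X :: "nat \<Rightarrow> 'g vfield"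
  assumes strat: "stratification (lie_algebra G A) V s"
    and basis: "adapted_orthonormal_basis (lie_algebra G A) V s ip n X"
begin

sublocale finite_frame "lie_algebra G A" n X
  using basis by unfold_locales (auto simp: adapted_orthonormal_basis_def)

lemma layer_above: "i > s \<Longrightarrow> V i = {0}"
  using strat by (simp add: stratification_def)

lemma layer_subspace:
  assumes "1 \<le> i" shows "subspace (V i)" "V i \<subseteq> \<gg>"
proof -
  have "subspace (V i) \<and> V i \<subseteq> \<gg>"
  proof (cases "i \<le> s")
    case True
    then have i: "i \<in> {1..s}" using assms by simp
    have ds: "is_direct_sum scaleR {1..s} V \<gg>" using strat by (simp add: stratification_def)
    have sub: "subspace (V k)" if "k \<in> {1..s}" for k
      using ds that by (simp add: is_direct_sum_def subspace_raw_def)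
    have bij: "bij_betw family_sum (finsupp_families {1..s} V) \<gg>"
      using ds by (simp add: is_direct_sum_def)
    have "v \<in> \<gg>" if v: "v \<in> V i" for v
    proof -
      let ?f = "\<lambda>k. if k = i then v else 0"
      have "?f \<in> finsupp_families {1..s} V"
        using v i subspace_0[OF sub] by (auto simp: finsupp_families_def)
      then have "family_sum ?f \<in> \<gg>" using bij by (rule bij_betw_apply[rotated])
      moreover have "family_sum ?f = v" using family_sum_single[of i ?f] by simp
      ultimately show ?thesis by simp
    qed
    then show ?thesis using sub[OF i] by blast
  next
    case False
    then show ?thesis
      using layer_above[of i] subspace_0[OF subspace_lie_algebra] by (simp add: subspace_single_0)
  qed
  then show "subspace (V i)" "V i \<subseteq> \<gg>" by auto
qed

lemma ip_linear:
  "x \<in> \<gg> \<Longrightarrow> y \<in> \<gg> \<Longrightarrow> z \<in> \<gg> \<Longrightarrow> ip (x + y) z = ip x z + ip y z"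
  "x \<in> \<gg> \<Longrightarrow> z \<in> \<gg> \<Longrightarrow> ip (c *\<^sub>R x) z = c * ip x z"
  using basis by (simp_all add: adapted_orthonormal_basis_def inner_product_on_def)

lemma ip_zero: "z \<in> \<gg> \<Longrightarrow> ip 0 z = 0"
  using ip_linear(2)[OF subspace_0[OF subspace_lie_algebra], of z 0] by simp

lemma ip_layers: "i \<in> {1..s} \<Longrightarrow> k \<in> {1..s} \<Longrightarrow> i \<noteq> k \<Longrightarrow> x \<in> V i \<Longrightarrow> y \<in> V k \<Longrightarrow> ip x y = 0"
  using basis by (simp add: adapted_orthonormal_basis_def)

lemma ip_frame: "i \<in> {1..n} \<Longrightarrow> j \<in> {1..n} \<Longrightarrow> ip (X i) (X j) = (if i = j then 1 else 0)"
  using basis by (simp add: adapted_orthonormal_basis_def)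

abbreviation "w \<equiv> weight V X"

text \<open>The weight of a frame vector is well defined, because a unit vector lying in two mutually orthogonal
  layers would be orthogonal to itself.\<close>

lemma weight_layer:
  assumes j: "j \<in> {1..n}"
  shows "1 \<le> w j" "w j \<le> s" "X j \<in> V (w j)"
proof -
  have "\<forall>j\<in>{1..n}. \<exists>i\<in>{1..s}. X j \<in> V i"
    using basis by (simp add: adapted_orthonormal_basis_def)
  then obtain i where i: "i \<in> {1..s}" "X j \<in> V i"
    using j by blast
  have "k = i" if "1 \<le> k" "X j \<in> V k" for k
  proof (rule ccontr)
    assume "k \<noteq> i"
    have "ip (X j) (X j) = 0"
    proof (cases "k \<le> s")
      case True
      then show ?thesis using ip_layers[OF _ i(1) \<open>k \<noteq> i\<close> that(2) i(2)] that(1) by simp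
    next
      case False
      then show ?thesis using layer_above[of k] that ip_zero[OF subspace_0[OF subspace_lie_algebra]] by simp
    qed
    then show False using ip_frame[OF j j] by simp
  qed
  then have "w j = i"
    unfolding weight_def using i by (intro the_equality) auto
  then show "1 \<le> w j" "w j \<le> s" "X j \<in> V (w j)" using i by auto
qed

lemma ip_dual:
  assumes "Z \<in> \<gg>" "l \<in> {1..n}"
  shows "ip Z (X l) = \<theta> l Z"
  using orthonormal_dual[OF _ _ assms] ip_frame basis by (simp add: adapted_orthonormal_basis_def)

text \<open>The dual covector \<open>\<theta>\<^sub>l\<close> is the inner product with \<open>X\<^sub>l\<close>, and the layers are orthogonal.\<close>

lemma dual_layer:
  assumes "Z \<in> V q" "1 \<le> q" "l \<in> {1..n}" "w l \<noteq> q"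
  shows "\<theta> l Z = 0"
proof -
  have Z: "Z \<in> \<gg>" using layer_subspace(2)[OF assms(2)] assms(1) by blast
  have "ip Z (X l) = 0"
  proof (cases "q \<le> s")
    case True
    then show ?thesis
      using weight_layer[OF assms(3)] assms(1,2,4) by (intro ip_layers[of q "w l"]) auto
  next
    case False
    then show ?thesis using layer_above[of q] assms(1) ip_zero[OF frame_in[OF assms(3)]] by simp
  qed
  then show ?thesis using ip_dual[OF Z assms(3)] by simp
qed

text \<open>The stratification gives this for \<open>p = 1\<close>. Since \<open>V\<^bsub>p+1\<^esub>\<close> is spanned by brackets of \<open>V\<^sub>1\<close> with \<open>V\<^sub>p\<close>,
  the general case follows by induction on \<open>p\<close> from the Jacobi identity
  \<open>[[U, W], Z] = [U, [W, Z]] - [W, [U, Z]]\<close>.\<close>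

lemma lie_bracket_layers:
  assumes "1 \<le> p" "1 \<le> q" "Y \<in> V p" "Z \<in> V q"
  shows "lie_bracket Y Z \<in> V (p + q)"
  using assms
proof (induction p arbitrary: q Y Z rule: nat_induct_at_least)
  have one: "lie_bracket Y Z \<in> V (Suc q)" if "Y \<in> V 1" "Z \<in> V q" "1 \<le> q" for q Y Z
  proof -
    have "lie_bracket Y Z \<in> span {lie_bracket X Y |X Y. X \<in> V 1 \<and> Y \<in> V q}"
      using that by (intro span_base) auto
    then show ?thesis using strat that(3) by (simp add: stratification_def)
  qed
  {
    case base
    then show ?case using one by simp
  next
    case (Suc p)
    have sub: "subspace (V (Suc p + q))" by (rule layer_subspace) simp
    have Z: "Z \<in> \<gg>" using layer_subspace(2)[of q] Suc.prems by blast
    have "Y \<in> span {lie_bracket U W |U W. U \<in> V 1 \<and> W \<in> V p}"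
      using strat Suc by (simp add: stratification_def)
    then have "Y \<in> \<gg> \<and> lie_bracket Y Z \<in> V (Suc p + q)"
    proof (induction rule: span_induct_alt)
      case base
      have 0: "lie_bracket 0 Z = 0"
        using lie_bracket_linear(2)[OF Z Z Z, of 0] by simp
      show ?case
        unfolding 0 using subspace_0[OF sub] subspace_0[OF subspace_lie_algebra] by blast
    next
      case (step c x y)
      then obtain U W where x: "x = lie_bracket U W" "U \<in> V 1" "W \<in> V p" by auto
      have UW: "U \<in> \<gg>" "W \<in> \<gg>"
        using x layer_subspace(2)[of 1] layer_subspace(2)[of p] Suc.hyps by auto
      have xg: "x \<in> \<gg>" using lie_bracket_closed[OF UW] x by simp
      have "lie_bracket W Z \<in> V (p + q)" using Suc.IH x Suc.prems by blast
      then have 1: "lie_bracket U (lie_bracket W Z) \<in> V (Suc p + q)"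
        using one[OF x(2), of _ "p + q"] Suc.prems by simp
      have "lie_bracket U Z \<in> V (Suc q)" using one x(2) Suc.prems by blast
      then have 2: "lie_bracket W (lie_bracket U Z) \<in> V (Suc p + q)"
        using Suc.IH[of "Suc q" W] x(3) by simp
      have 3: "lie_bracket x Z \<in> V (Suc p + q)"
        unfolding x(1) jacobi[OF UW Z] using 1 2 by (intro subspace_diff[OF sub])
      have y: "y \<in> \<gg>" "lie_bracket y Z \<in> V (Suc p + q)" using step by blast+
      have cx: "c *\<^sub>R x \<in> \<gg>" by (rule subspace_scale[OF subspace_lie_algebra xg])
      have "lie_bracket (c *\<^sub>R x + y) Z = c *\<^sub>R lie_bracket x Z + lie_bracket y Z"
        by (simp only: lie_bracket_linear(1)[OF cx y(1) Z] lie_bracket_linear(2)[OF xg xg Z])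
      also have "\<dots> \<in> V (Suc p + q)"
        by (intro subspace_add[OF sub] subspace_scale[OF sub] 3 y(2))
      finally show ?case
        using subspace_add[OF subspace_lie_algebra cx y(1)] by blast
    qed
    then show ?case by blast
  }
qed

section \<open>Forms of pure weight\<close>

abbreviation "wt J \<equiv> (\<Sum>j\<leftarrow>J. w j)"

text \<open>The index lists of the wedge products that span \<open>\<Lambda>\<^bsup>a,b\<^esup>\<gg>\<^sup>*\<close>. There are none when \<open>a + b < 0\<close>.\<close>

definition bidegree_lists :: "int \<times> int \<Rightarrow> nat list set" where
  "bidegree_lists = (\<lambda>(a, b). {J. set J \<subseteq> {1..n} \<and> int (length J) = a + b \<and> int (wt J) = a})"

definition tensor :: "'g vfield covector \<Rightarrow> ('g \<Rightarrow> real) \<Rightarrow> 'g dform" where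
  "tensor \<omega> f = (\<lambda>Ys. \<omega> Ys *\<^sub>R f)"

text \<open>The terms of bidegree \<open>p\<close> in the expansion of a form in wedge products.\<close>

definition proj :: "int \<times> int \<Rightarrow> 'g dform \<Rightarrow> 'g dform" where
  "proj p \<alpha> = (\<Sum>J\<in>bidegree_lists p. (1 / fact (length J)) *\<^sub>R tensor (wedge (map \<theta> J)) (\<alpha> (map X J)))"

abbreviation "M \<equiv> weighted_forms A V n X"

lemma bidegree_lists_index: "a + b = int h \<Longrightarrow> bidegree_lists (a, b) = {J \<in> index_lists n h. int (wt J) = a}"
  by (auto simp: bidegree_lists_def index_lists_def)

lemma tensor_linear:
  "tensor \<omega> (f + g) = tensor \<omega> f + tensor \<omega> g" "tensor \<omega> (c *\<^sub>R f) = c *\<^sub>R tensor \<omega> f"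
  "tensor \<omega> 0 = 0"
  by (simp_all add: tensor_def fun_eq_iff scaleR_apply algebra_simps)

lemma weighted_forms_span:
  "M p = span {tensor \<omega> f |\<omega> f. \<omega> \<in> weighted_covectors V n X p \<and> f \<in> F}"
  by (simp add: weighted_forms_def tensor_smooth_def tensor_def)

lemma forms_span:
  "forms G A h = span {tensor \<omega> f |\<omega> f. \<omega> \<in> alternating_covectors \<gg> h \<and> f \<in> F}"
  by (simp add: forms_def tensor_smooth_def tensor_def)

lemma weighted_covectors_span:
  "weighted_covectors V n X p = span {wedge (map \<theta> J) |J. J \<in> bidegree_lists p}"
  by (auto simp: weighted_covectors_def bidegree_lists_def split_def intro!: arg_cong[where f = span])

lemma weighted_covectors_alternating:
  assumes "a + b = int h" "\<omega> \<in> weighted_covectors V n X (a, b)"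
  shows "\<omega> \<in> alternating_covectors \<gg> h"
proof -
  have "{wedge (map \<theta> J) |J. J \<in> bidegree_lists (a, b)} \<subseteq> alternating_covectors \<gg> h"
    using assms(1) wedge_alternating by (auto simp: bidegree_lists_def)
  then show ?thesis
    using span_minimal[OF _ subspace_alternating_covectors] assms(2) unfolding weighted_covectors_span by blast
qed

lemma weighted_covectors_pure:
  assumes "\<omega> \<in> weighted_covectors V n X p" "set K \<subseteq> {1..n}" "K \<notin> bidegree_lists p"
  shows "\<omega> (map X K) = 0"
proof -
  have "subspace {\<omega> :: 'g vfield covector. \<omega> (map X K) = 0}"
    by (auto simp: subspace_def scaleR_apply)
  moreover have "wedge (map \<theta> J) (map X K) = 0" if J: "J \<in> bidegree_lists p" for J
  proof (rule ccontr)
    assume "wedge (map \<theta> J) (map X K) \<noteq> 0"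
    then have m: "mset J = mset K"
      using wedge_frame_nonzero assms(2) J by (auto simp: bidegree_lists_def split_def)
    then have "length J = length K" "wt J = wt K"
      by (metis size_mset, metis mset_map sum_mset_sum_list)
    then show False using J assms(2,3) by (simp add: bidegree_lists_def split_def)
  qed
  ultimately have "weighted_covectors V n X p \<subseteq> {\<omega>. \<omega> (map X K) = 0}"
    unfolding weighted_covectors_span by (intro span_minimal) auto
  then show ?thesis using assms(1) by blast
qed

lemma tensor_form:
  assumes "\<omega> \<in> alternating_covectors \<gg> h" "f \<in> F"
  shows "tensor \<omega> f \<in> alternating_forms h"
proof (rule alternating_formsI)
  show "tensor \<omega> f \<in> smooth_valued"
    using F_closed(5)[OF assms(2)] by (simp add: smooth_valued_def tensor_def)
  fix x
  have "(\<lambda>Ys. tensor \<omega> f Ys x) = f x *\<^sub>R \<omega>"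
    by (simp add: tensor_def fun_eq_iff scaleR_apply)
  then show "(\<lambda>Ys. tensor \<omega> f Ys x) \<in> alternating_covectors \<gg> h"
    using subspace_scale[OF subspace_alternating_covectors assms(1)] by simp
qed

lemma tensor_wedge_weighted:
  assumes "J \<in> bidegree_lists p" "f \<in> F"
  shows "tensor (wedge (map \<theta> J)) f \<in> M p"
  unfolding weighted_forms_span weighted_covectors_span using assms by (auto intro!: span_base)

lemma weighted_forms_alternating:
  assumes "a + b = int h" "\<alpha> \<in> M (a, b)"
  shows "\<alpha> \<in> alternating_forms h"
proof -
  have "{tensor \<omega> f |\<omega> f. \<omega> \<in> weighted_covectors V n X (a, b) \<and> f \<in> F} \<subseteq> alternating_forms h"
    using tensor_form weighted_covectors_alternating[OF assms(1)] by blast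
  then show ?thesis
    using span_minimal[OF _ subspace_alternating_forms] assms(2) unfolding weighted_forms_span by blast
qed

lemma weighted_forms_negative:
  assumes "a + b < 0" "\<alpha> \<in> M (a, b)"
  shows "\<alpha> = 0"
proof -
  have "bidegree_lists (a, b) = {}" using assms(1) by (auto simp: bidegree_lists_def)
  then have "weighted_covectors V n X (a, b) = {0}" by (simp add: weighted_covectors_span)
  then have "{tensor \<omega> f |\<omega> f. \<omega> \<in> weighted_covectors V n X (a, b) \<and> f \<in> F} \<subseteq> {0}"
    by (auto simp: tensor_def fun_eq_iff)
  then have "M (a, b) \<subseteq> {0}"
    unfolding weighted_forms_span by (rule span_minimal) (simp add: subspace_single_0)
  then show ?thesis using assms(2) by blast
qed

text \<open>A form of bidegree \<open>p\<close> vanishes on all frame vectors of other bidegrees, since this holds for the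
  generating wedge products. Hence the projections to different bidegrees annihilate each other.\<close>

lemma weighted_forms_pure:
  assumes "\<alpha> \<in> M p" "set K \<subseteq> {1..n}" "K \<notin> bidegree_lists p"
  shows "\<alpha> (map X K) = 0"
proof -
  have "subspace {\<alpha> :: 'g dform. \<alpha> (map X K) = 0}"
    by (simp add: subspace_def scaleR_apply)
  moreover have "{tensor \<omega> f |\<omega> f. \<omega> \<in> weighted_covectors V n X p \<and> f \<in> F} \<subseteq> {\<alpha>. \<alpha> (map X K) = 0}"
    using weighted_covectors_pure[OF _ assms(2,3)] by (auto simp: tensor_def)
  ultimately have "M p \<subseteq> {\<alpha>. \<alpha> (map X K) = 0}"
    unfolding weighted_forms_span by (intro span_minimal)
  then show ?thesis using assms(1) by blast
qed

lemma form_expansion: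
  assumes "\<alpha> \<in> alternating_forms h"
  shows "\<alpha> = (\<Sum>J\<in>index_lists n h. (1 / fact (length J)) *\<^sub>R tensor (wedge (map \<theta> J)) (\<alpha> (map X J)))"
proof (intro ext)
  fix Ys x
  have "\<alpha> Ys x = (\<Sum>J\<in>index_lists n h. wedge (map \<theta> J) Ys * \<alpha> (map X J) x) / fact h"
    by (rule wedge_expansion[OF form_at[OF assms]])
  also have "\<dots> = (\<Sum>J\<in>index_lists n h. ((1 / fact (length J)) *\<^sub>R tensor (wedge (map \<theta> J)) (\<alpha> (map X J))) Ys x)"
    unfolding sum_divide_distrib
    by (intro sum.cong) (auto simp: scaleR_apply tensor_def index_lists_def)
  also have "\<dots> = (\<Sum>J\<in>index_lists n h. (1 / fact (length J)) *\<^sub>R tensor (wedge (map \<theta> J)) (\<alpha> (map X J))) Ys x"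
    by (simp only: sum_fun_apply)
  finally show "\<alpha> Ys x = (\<Sum>J\<in>index_lists n h. (1 / fact (length J)) *\<^sub>R tensor (wedge (map \<theta> J)) (\<alpha> (map X J))) Ys x" .
qed

lemma proj_vanishes:
  assumes "\<And>J. J \<in> bidegree_lists p \<Longrightarrow> \<alpha> (map X J) = 0"
  shows "proj p \<alpha> = 0"
  unfolding proj_def using assms by (intro sum.neutral) (auto simp: tensor_linear)

lemma proj_same:
  assumes "\<alpha> \<in> M p" shows "proj p \<alpha> = \<alpha>"
proof (cases p)
  case (Pair a b)
  show ?thesis
  proof (cases "a + b < 0")
    case True
    then have 0: "\<alpha> = 0"
      using weighted_forms_negative assms by (auto simp: Pair)
    show ?thesis
      unfolding 0 by (rule proj_vanishes) (rule zero_fun_apply)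
  next
    case False
    define h where "h = nat (a + b)"
    have h: "a + b = int h" using False by (simp add: h_def)
    have form: "\<alpha> \<in> alternating_forms h"
      using weighted_forms_alternating[OF h] assms by (simp add: Pair)
    have "proj p \<alpha> = (\<Sum>J\<in>index_lists n h. (1 / fact (length J)) *\<^sub>R tensor (wedge (map \<theta> J)) (\<alpha> (map X J)))"
      unfolding proj_def
    proof (rule sum.mono_neutral_left[OF finite_index_lists])
      show "bidegree_lists p \<subseteq> index_lists n h"
        using bidegree_lists_index[OF h] by (auto simp: Pair)
      show "\<forall>J\<in>index_lists n h - bidegree_lists p.
          (1 / fact (length J)) *\<^sub>R tensor (wedge (map \<theta> J)) (\<alpha> (map X J)) = 0"
        using weighted_forms_pure[OF assms] by (auto simp: index_lists_def tensor_linear)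
    qed
    then show ?thesis using form_expansion[OF form] by simp
  qed
qed

lemma proj_other:
  assumes "\<alpha> \<in> M p" "q \<noteq> p" shows "proj q \<alpha> = 0"
proof (rule proj_vanishes)
  fix J assume "J \<in> bidegree_lists q"
  then show "\<alpha> (map X J) = 0"
    using weighted_forms_pure[OF assms(1), of J] assms(2)
    by (auto simp: bidegree_lists_def split_def prod_eq_iff)
qed

lemma proj_linear: "proj p (\<alpha> + \<beta>) = proj p \<alpha> + proj p \<beta>" "proj p (c *\<^sub>R \<alpha>) = c *\<^sub>R proj p \<alpha>"
  by (simp_all add: proj_def scaleR_apply tensor_linear scaleR_add_right sum.distrib scaleR_sum_right mult.commute)

text \<open>All three spaces coincide: products \<open>\<omega> \<otimes> f\<close> are alternating, and the expansion in wedge products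
  writes an alternating form as a sum of products, each of which is homogeneous.\<close>

lemma forms_eq_alternating_forms: "forms G A h = alternating_forms h"
  and span_weighted_forms: "span (\<Union>p\<in>{(a, b). a + b = int h}. M p) = alternating_forms h"
proof -
  let ?U = "\<Union>p\<in>{(a, b). a + b = int h}. M p"
  have 1: "forms G A h \<subseteq> alternating_forms h"
    unfolding forms_span by (rule span_minimal[OF _ subspace_alternating_forms]) (use tensor_form in blast)
  have 2: "span ?U \<subseteq> alternating_forms h"
    by (rule span_minimal[OF _ subspace_alternating_forms]) (use weighted_forms_alternating in auto)
  have 3: "\<alpha> \<in> forms G A h" and 4: "\<alpha> \<in> span ?U" if \<alpha>: "\<alpha> \<in> alternating_forms h" for \<alpha>
  proof -
    have F: "\<alpha> Ys \<in> F" for Ys by (rule smooth_valuedD[OF form_smooth[OF \<alpha>]])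
    have t: "tensor (wedge (map \<theta> J)) (\<alpha> (map X J)) \<in> forms G A h \<and>
        tensor (wedge (map \<theta> J)) (\<alpha> (map X J)) \<in> span ?U" if J: "J \<in> index_lists n h" for J
    proof
      have "wedge (map \<theta> J) \<in> alternating_covectors \<gg> h"
        using wedge_alternating[of J] J by (simp add: index_lists_def)
      then show "tensor (wedge (map \<theta> J)) (\<alpha> (map X J)) \<in> forms G A h"
        unfolding forms_span using F by (intro span_base) blast
      have "J \<in> bidegree_lists (int (wt J), int h - int (wt J))"
        using J by (simp add: bidegree_lists_def index_lists_def)
      from tensor_wedge_weighted[OF this F]
      show "tensor (wedge (map \<theta> J)) (\<alpha> (map X J)) \<in> span ?U"
        by (intro span_base UN_I[of "(int (wt J), int h - int (wt J))"]) auto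
    qed
    have sub: "subspace (forms G A h)" by (simp add: forms_span)
    show "\<alpha> \<in> forms G A h"
      by (subst form_expansion[OF \<alpha>]) (intro subspace_sum[OF sub] subspace_scale[OF sub], use t in blast)
    show "\<alpha> \<in> span ?U"
      by (subst form_expansion[OF \<alpha>]) (intro span_sum span_scale, use t in blast)
  qed
  show "forms G A h = alternating_forms h" using 1 3 by blast
  show "span ?U = alternating_forms h" using 2 4 by blast
qed

lemma all_forms_eq: "all_forms G A = span (\<Union>p. M p)"
proof
  have "forms G A h \<subseteq> span (\<Union>p. M p)" for h
    unfolding forms_eq_alternating_forms span_weighted_forms[symmetric] by (rule span_mono) blast
  then show "all_forms G A \<subseteq> span (\<Union>p. M p)"
    unfolding all_forms_def by (intro span_minimal) auto
  have "M p \<subseteq> all_forms G A" for p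
  proof
    fix \<alpha> assume \<alpha>: "\<alpha> \<in> M p"
    obtain a b where p: "p = (a, b)" by (cases p)
    show "\<alpha> \<in> all_forms G A"
    proof (cases "a + b < 0")
      case True
      then have 0: "\<alpha> = 0" using weighted_forms_negative \<alpha> by (auto simp: p)
      show ?thesis unfolding 0 all_forms_def by (rule span_zero)
    next
      case False
      then have "\<alpha> \<in> forms G A (nat (a + b))"
        unfolding forms_eq_alternating_forms using \<alpha> by (intro weighted_forms_alternating[of a b]) (auto simp: p)
      then show ?thesis unfolding all_forms_def by (auto intro: span_base)
    qed
  qed
  then show "span (\<Union>p. M p) \<subseteq> all_forms G A"
    by (intro span_minimal) (auto simp: all_forms_def)
qed

section \<open>The exterior derivative and weights\<close>

text \<open>The property of forms of weight \<open>a\<close> that is passed on to contractions, and hence suits inductions on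
  the number of arguments.\<close>

definition pure_weight :: "int \<Rightarrow> 'g dform \<Rightarrow> bool" where
  "pure_weight a \<alpha> \<longleftrightarrow> (\<forall>K. set K \<subseteq> {1..n} \<and> int (wt K) \<noteq> a \<longrightarrow> \<alpha> (map X K) = 0)"

lemma pure_weightD:
  "pure_weight a \<alpha> \<Longrightarrow> set K \<subseteq> {1..n} \<Longrightarrow> int (wt K) \<noteq> a \<Longrightarrow> \<alpha> (map X K) = 0"
  unfolding pure_weight_def by blast

lemma pure_weight_contract:
  assumes "pure_weight a \<alpha>" "k \<in> {1..n}"
  shows "pure_weight (a - int (w k)) (contract (X k) \<alpha>)"
  unfolding pure_weight_def
proof (intro allI impI)
  fix K assume K: "set K \<subseteq> {1..n} \<and> int (wt K) \<noteq> a - int (w k)"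
  have "\<alpha> (map X (k # K)) = 0"
    using K assms(2) by (intro pure_weightD[OF assms(1)]) auto
  then show "contract (X k) \<alpha> (map X K) = 0" by (simp only: contract_def list.map)
qed

text \<open>A vector of layer \<open>q\<close> counts as a frame vector of weight \<open>q\<close>, because it is a combination of these.\<close>

lemma pure_weight_layer:
  assumes "\<alpha> \<in> alternating_forms h" "pure_weight a \<alpha>" "Z \<in> V q" "1 \<le> q" "set K \<subseteq> {1..n}" "int (q + wt K) \<noteq> a"
  shows "\<alpha> (Z # map X K) = 0"
proof
  fix x
  have Z: "Z \<in> \<gg>" using assms(3,4) layer_subspace(2) by blast
  have "\<alpha> (Z # map X K) x = \<alpha> ((\<Sum>l\<in>{1..n}. \<theta> l Z *\<^sub>R X l) # map X K) x"
    by (rule arg_cong[where f = "\<lambda>Y. \<alpha> (Y # map X K) x"]) (rule frame_expansion[OF Z])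
  also have "\<dots> = (\<Sum>l\<in>{1..n}. \<theta> l Z * \<alpha> (X l # map X K) x)"
    by (rule alternating_head_sum[OF form_at[OF assms(1)] subspace_lie_algebra frame_in])
  also have "\<dots> = 0"
  proof (rule sum.neutral, rule ballI)
    fix l assume l: "l \<in> {1..n}"
    show "\<theta> l Z * \<alpha> (X l # map X K) x = 0"
    proof (cases "w l = q")
      case True
      then have "\<alpha> (map X (l # K)) = 0"
        using assms(5,6) l by (intro pure_weightD[OF assms(2)]) auto
      then show ?thesis by simp
    qed (simp add: dual_layer[OF assms(3,4) l])
  qed
  finally show "\<alpha> (Z # map X K) x = 0 x" by simp
qed

text \<open>The derivative along \<open>X\<^sub>k\<close> keeps the weight; replacing an argument by its bracket with \<open>X\<^sub>k\<close> adds
  \<open>w k\<close> to the weight of the arguments.\<close>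

lemma pure_weight_lie_derivative:
  assumes "\<alpha> \<in> alternating_forms h" "pure_weight a \<alpha>" "k \<in> {1..n}" "set K \<subseteq> {1..n}"
    "int (wt K) \<noteq> a" "int (wt K) \<noteq> a - int (w k)"
  shows "\<L> (X k) \<alpha> (map X K) = 0"
  using assms(1,2,4-)
proof (induction K arbitrary: \<alpha> a h)
  case Nil
  then have "\<alpha> (map X []) = 0" by (intro pure_weightD[OF Nil(2)]) auto
  then show ?case using lie_algebra_linear(1)[OF frame_in[OF assms(3)]] by simp
next
  case (Cons j K)
  have j: "j \<in> {1..n}" using Cons.prems by simp
  have "\<L> (X k) (contract (X j) \<alpha>) (map X K) = 0"
    by (rule Cons.IH[OF form_contract[OF Cons.prems(1) frame_in[OF j]] pure_weight_contract[OF Cons.prems(2) j]])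
      (use Cons.prems in auto)
  moreover have "\<alpha> (lie_bracket (X k) (X j) # map X K) = 0"
    using weight_layer[OF assms(3)] weight_layer[OF j] Cons.prems
    by (intro pure_weight_layer[OF Cons.prems(1,2) lie_bracket_layers[of "w k" "w j"]]) auto
  moreover have "\<L> (X k) \<alpha> (map X (j # K)) =
      \<L> (X k) (contract (X j) \<alpha>) (map X K) - \<alpha> (lie_bracket (X k) (X j) # map X K)"
    using frame_in[OF j] by simp
  ultimately show ?case by (simp only: diff_zero)
qed

text \<open>By Cartan's formula, with \<open>K\<close> built up one index at a time. A first index \<open>k\<close> contributes through
  \<open>\<L>\<^sub>k \<alpha>\<close>, with \<open>X\<^sub>k\<close> as the direction, which leads to total weight \<open>a + w k\<close> or \<open>a\<close>. Otherwise the
  claim is the one for \<open>\<iota>\<^sub>k \<alpha>\<close>, of weight \<open>a - w k\<close>.\<close>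

lemma pure_weight_d:
  assumes "\<alpha> \<in> alternating_forms h" "pure_weight a \<alpha>" "set K \<subseteq> {1..n}"
    "\<not> (a \<le> int (wt K) \<and> int (wt K) \<le> a + int s)"
  shows "d \<alpha> (map X K) = 0"
  using assms
proof (induction K arbitrary: \<alpha> a h)
  case Nil
  show ?case by (simp add: d_Nil)
next
  case (Cons k K)
  have k: "k \<in> {1..n}" using Cons.prems by simp
  have "d \<alpha> (map X (k # K)) = contract (X k) (d \<alpha>) (map X K)" by (simp add: contract_def)
  also have "\<dots> = \<L> (X k) \<alpha> (map X K) - d (contract (X k) \<alpha>) (map X K)"
    by (simp only: contract_d[OF Cons.prems(1) frame_in[OF k]] minus_apply)
  also have "\<L> (X k) \<alpha> (map X K) = 0"
    using Cons.prems weight_layer[OF k] by (intro pure_weight_lie_derivative[OF Cons.prems(1,2) k]) auto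
  also have "d (contract (X k) \<alpha>) (map X K) = 0"
    by (rule Cons.IH[OF form_contract[OF Cons.prems(1) frame_in[OF k]] pure_weight_contract[OF Cons.prems(2) k]])
      (use Cons.prems in auto)
  finally show ?case by (simp only: diff_zero)
qed

sublocale weighted_differential M proj d s
proof
  show "subspace (M p)" for p by (simp add: weighted_forms_span)
  show "linear_on (span (\<Union>p. M p)) d"
  proof -
    have "M p \<subseteq> smooth_valued" for p
    proof (cases p)
      case (Pair a b)
      show ?thesis
      proof (cases "a + b < 0")
        case True
        then show ?thesis using weighted_forms_negative smooth_valued_closed(1) by (auto simp: Pair)
      next
        case False
        then show ?thesis
          using weighted_forms_alternating[of a b "nat (a + b)"] form_smooth by (auto simp: Pair)
      qed
    qed
    then have "span (\<Union>p. M p) \<subseteq> smooth_valued"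
      by (intro span_minimal subspace_smooth_valued) auto
    then show ?thesis by (auto simp: linear_on_def d_add d_scale subset_iff)
  qed
next
  fix \<alpha> a b assume \<alpha>: "\<alpha> \<in> M (a, b)"
  show "d \<alpha> \<in> span (\<Union>p\<in>{(a', b'). a' + b' = a + b + 1}. M p)"
  proof (cases "a + b < 0")
    case True
    then have 0: "\<alpha> = 0" using weighted_forms_negative[OF _ \<alpha>] by blast
    show ?thesis unfolding 0 d_zero by (rule span_zero)
  next
    case False
    define h where "h = nat (a + b)"
    have h: "a + b = int h" using False by (simp add: h_def)
    have "d \<alpha> \<in> alternating_forms (Suc h)" by (rule d_form[OF weighted_forms_alternating[OF h \<alpha>]])
    then show ?thesis using span_weighted_forms[of "Suc h"] h by (simp add: add.commute)
  qed
next
  fix \<alpha> a b c e assume \<alpha>: "\<alpha> \<in> M (a, b)" and c: "\<not> (a \<le> c \<and> c \<le> a + int s)"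
  show "proj (c, e) (d \<alpha>) = 0"
  proof (cases "a + b < 0")
    case True
    then have 0: "\<alpha> = 0" using weighted_forms_negative[OF _ \<alpha>] by blast
    show ?thesis unfolding 0 d_zero by (rule proj_vanishes) (rule zero_fun_apply)
  next
    case False
    then have form: "\<alpha> \<in> alternating_forms (nat (a + b))"
      by (intro weighted_forms_alternating[OF _ \<alpha>]) simp
    have pure: "pure_weight a \<alpha>"
      using weighted_forms_pure[OF \<alpha>] by (auto simp: pure_weight_def bidegree_lists_def)
    show ?thesis
      by (rule proj_vanishes, rule pure_weight_d[OF form pure]) (use c in \<open>auto simp: bidegree_lists_def\<close>)
  qed
next
  fix \<alpha> p assume \<alpha>: "\<alpha> \<in> M p"
  obtain a b where p: "p = (a, b)" by (cases p)
  show "d (d \<alpha>) = 0"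
  proof (cases "a + b < 0")
    case True
    then have 0: "\<alpha> = 0" using weighted_forms_negative \<alpha> by (auto simp: p)
    show ?thesis unfolding 0 d_zero ..
  next
    case False
    then show ?thesis
      using d_d[OF weighted_forms_alternating[of a b "nat (a + b)"]] \<alpha> by (simp add: p)
  qed
qed (rule proj_linear proj_same proj_other; assumption?)+

end

theorem proposition3p11:
  fixes G :: "('g::{t2_space, second_countable_topology}) monoid"
    and A :: "('g, 'e::euclidean_space) chart set"
    and V :: "nat \<Rightarrow> 'g vfield set"
    and s n :: nat
    and ip :: "'g vfield \<Rightarrow> 'g vfield \<Rightarrow> real"
    and X :: "nat \<Rightarrow> 'g vfield"
  assumes "carnot_group G A V s"
    and "adapted_orthonormal_basis (lie_algebra G A) V s ip n X"
  shows "(\<forall>h. is_direct_sum scaleR {(a, b). a + b = int h} (weighted_forms A V n X) (forms G A h))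
    \<and> (\<forall>\<alpha>\<in>all_forms G A. ext_deriv G A \<alpha> = (\<Sum>i\<le>s. d_part G A V n X i \<alpha>))
    \<and> (\<forall>i>s. \<forall>\<alpha>\<in>all_forms G A. d_part G A V n X i \<alpha> = 0)
    \<and> multicomplex scaleR (all_forms G A) (weighted_forms A V n X) (d_part G A V n X)"
proof -
  interpret carnot_frame G A V s n ip X
    using assms by unfold_locales (auto simp: carnot_group_def lie_group_def)
  have "is_direct_sum scaleR {(a, b). a + b = int h} (weighted_forms A V n X) (forms G A h)" for h
    using direct_sum_span[of "{(a, b). a + b = int h}"]
    by (simp add: span_weighted_forms forms_eq_alternating_forms)
  then show ?thesis
    using D_decomposition raising_part_vanishes multicomplex_raising_part
    by (simp add: total_def all_forms_eq d_part_def)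
qed

end
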